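(* Let $\lambda,\omega>0$, let $\Omega=\omega$ (i.e. zero detuning $\Delta=\Omega-\omega=0$), and let $g=\lambda/\omega$. For every $j\in\{1,2\}$ and every integer $n\ge1$, the Fock state $\Phi_{j,n}=e_j\otimes\varphi_n$ satisfies $$5g\sqrt{n+3}\;\ge\;\sup_{t\in[0,\pi/\omega]}\|(U_2(t)-U_1(t))\Phi_{j,n}\|\;\ge\;\frac16-\frac{1}{216\,g^2n}-\frac{7}{12\,n}.$$
   Context: On Schwartz space $\mathscr{S}(\mathbb{R})\subset L^2(\mathbb{R})$ let $a=\frac{1}{\sqrt2}(x+\frac{d}{dx})$ and $a^\dagger=\frac{1}{\sqrt2}(x-\frac{d}{dx})$, so $[a,a^\dagger]=I$. Let $\{\varphi_n\}_{n\ge0}$ be the orthonormal eigenbasis of $a^\dagger a$ in $L^2(\mathbb{R})$, $a^\dagger a\,\varphi_n=n\varphi_n$, and let $e_1=(1,0)^T$, $e_2=(0,1)^T$ be the canonical basis of $\mathbb{C}^2$. Let $$\sigma_x=\begin{pmatrix}0&1\\1&0\end{pmatrix},\quad \sigma_z=\begin{pmatrix}1&0\\0&-1\end{pmatrix},\quad \sigma_+=\begin{pmatrix}0&1\\0&0\end{pmatrix},\quad \sigma_-=\begin{pmatrix}0&0\\1&0\end{pmatrix}.$$ On $\mathbb{C}^2\otimes\mathscr{S}(\mathbb{R})$ (algebraic tensor product, a subspace of the Hilbert space $\mathbb{C}^2\otimes L^2(\mathbb{R})$) define $$H=\tfrac{\Omega}{2}\sigma_z\otimes I+I\otimes\omega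 a^\dagger a+\lambda\,\sigma_x\otimes(a+a^\dagger),$$ $$H_{\mathrm{RWA}}=\tfrac{\Omega}{2}\sigma_z\otimes I+I\otimes\omega a^\dagger a+\lambda(\sigma_+\otimes a+\sigma_-\otimes a^\dagger),$$ $$H_0=\tfrac{\omega}{2}\sigma_z\otimes I+I\otimes\omega a^\dagger a.$$ The same symbols denote the closures, which are self-adjoint ($\mathbb{C}^2\otimes\mathscr{S}(\mathbb{R})$ is a core). For $t\in\mathbb{R}$ set $U_1(t)=e^{itH_0}e^{-itH}$ and $U_2(t)=e^{itH_0}e^{-itH_{\mathrm{RWA}}}$. *)

theory Defs
  imports "HOL-Analysis.Analysis"
begin

section \<open>The Hilbert space of square-integrable functions on the line\<close>

definition square_integrable :: "(real \<Rightarrow> complex) \<Rightarrow> bool" where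
  "square_integrable f \<longleftrightarrow>
     f \<in> borel_measurable lborel \<and> integrable lborel (\<lambda>x. (cmod (f x))\<^sup>2)"

lemma cnj_measurable [measurable]: "cnj \<in> borel_measurable borel"
  by (intro borel_measurable_continuous_onI continuous_intros)

lemma square_integrable_zero: "square_integrable (\<lambda>_. 0)"
  by (simp add: square_integrable_def)

lemma square_integrable_scale:
  assumes "square_integrable f"
  shows "square_integrable (\<lambda>x. c * f x)"
proof -
  have [measurable]: "f \<in> borel_measurable borel"
    using assms by (simp add: square_integrable_def)
  have "(\<lambda>x. c * f x) \<in> borel_measurable borel"
    by measurable
  then show ?thesis
    using assms by (simp add: square_integrable_def norm_mult power_mult_distrib)
qed

lemma square_integrable_add:
  assumes f: "square_integrable f" and g: "square_integrable g"
  shows "square_integrable (\<lambda>x. f x + g x)"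
proof -
  have [measurable]: "f \<in> borel_measurable borel" "g \<in> borel_measurable borel"
    using f g by (simp_all add: square_integrable_def)
  have "integrable lborel (\<lambda>x. (cmod (f x + g x))\<^sup>2)"
  proof (rule Bochner_Integration.integrable_bound)
    show "integrable lborel (\<lambda>x. 2 * (cmod (f x))\<^sup>2 + 2 * (cmod (g x))\<^sup>2)"
      using f g by (simp add: square_integrable_def)
    have "(cmod (f x + g x))\<^sup>2 \<le> 2 * (cmod (f x))\<^sup>2 + 2 * (cmod (g x))\<^sup>2" for x
    proof -
      have "(cmod (f x + g x))\<^sup>2 \<le> (cmod (f x) + cmod (g x))\<^sup>2"
        by (intro power_mono norm_triangle_ineq) simp
      moreover have "0 \<le> (cmod (f x) - cmod (g x))\<^sup>2"
        by simp
      ultimately show ?thesis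
        by (simp add: power2_eq_square algebra_simps)
    qed
    then show "AE x in lborel. norm ((cmod (f x + g x))\<^sup>2)
        \<le> norm (2 * (cmod (f x))\<^sup>2 + 2 * (cmod (g x))\<^sup>2)"
      by simp
  qed measurable
  then show ?thesis
    by (simp add: square_integrable_def)
qed

lemma square_integrable_uminus:
  "square_integrable f \<Longrightarrow> square_integrable (\<lambda>x. - f x)"
  using square_integrable_scale[of f "-1"] by simp

lemma square_integrable_diff:
  "square_integrable f \<Longrightarrow> square_integrable g \<Longrightarrow> square_integrable (\<lambda>x. f x - g x)"
  using square_integrable_add[OF _ square_integrable_uminus] by fastforce

lemma square_integrable_cnj_mult:
  assumes f: "square_integrable f" and g: "square_integrable g"
  shows "integrable lborel (\<lambda>x. cnj (f x) * g x)"
proof (rule Bochner_Integration.integrable_bound)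
  have [measurable]: "f \<in> borel_measurable lborel" "g \<in> borel_measurable lborel"
    using f g by (simp_all add: square_integrable_def)
  show "(\<lambda>x. cnj (f x) * g x) \<in> borel_measurable lborel"
    by measurable
  show "integrable lborel (\<lambda>x. (cmod (f x))\<^sup>2 + (cmod (g x))\<^sup>2)"
    using f g by (simp add: square_integrable_def)
  have "cmod (f x) * cmod (g x) \<le> (cmod (f x))\<^sup>2 + (cmod (g x))\<^sup>2" for x
  proof -
    have "0 \<le> (cmod (f x) - cmod (g x))\<^sup>2" "0 \<le> cmod (f x) * cmod (g x)"
      by simp_all
    then show ?thesis
      unfolding power2_diff by linarith
  qed
  then show "AE x in lborel. norm (cnj (f x) * g x)
      \<le> norm ((cmod (f x))\<^sup>2 + (cmod (g x))\<^sup>2)"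
    by (simp add: norm_mult)
qed

definition ltwo_rel :: "(real \<Rightarrow> complex) \<Rightarrow> (real \<Rightarrow> complex) \<Rightarrow> bool" where
  "ltwo_rel f g \<longleftrightarrow>
     square_integrable f \<and> square_integrable g \<and> (AE x in lborel. f x = g x)"

quotient_type ltwo = "real \<Rightarrow> complex" / partial: ltwo_rel
proof (rule part_equivpI)
  show "\<exists>f. ltwo_rel f f"
    by (rule exI[of _ "\<lambda>_. 0"]) (simp add: ltwo_rel_def square_integrable_zero)
  show "symp ltwo_rel"
    by (auto intro!: sympI simp: ltwo_rel_def eq_commute)
  show "transp ltwo_rel"
  proof (rule transpI)
    fix f g h assume *: "ltwo_rel f g" "ltwo_rel g h"
    then have "AE x in lborel. f x = g x" "AE x in lborel. g x = h x"
      by (simp_all add: ltwo_rel_def)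
    then have "AE x in lborel. f x = h x"
      by eventually_elim simp
    then show "ltwo_rel f h"
      using * by (simp add: ltwo_rel_def)
  qed
qed

lift_definition cinner_ltwo :: "ltwo \<Rightarrow> ltwo \<Rightarrow> complex"
  is "\<lambda>f g. \<integral>x. cnj (f x) * g x \<partial>lborel"
proof -
  fix f f' g g' assume *: "ltwo_rel f f'" "ltwo_rel g g'"
  then have [measurable]: "f \<in> borel_measurable borel" "g \<in> borel_measurable borel"
    "f' \<in> borel_measurable borel" "g' \<in> borel_measurable borel"
    by (simp_all add: ltwo_rel_def square_integrable_def)
  from * have "AE x in lborel. f x = f' x" "AE x in lborel. g x = g' x"
    by (simp_all add: ltwo_rel_def)
  then have "AE x in lborel. cnj (f x) * g x = cnj (f' x) * g' x"
    by eventually_elim simp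
  then show "(\<integral>x. cnj (f x) * g x \<partial>lborel) = (\<integral>x. cnj (f' x) * g' x \<partial>lborel)"
    by (intro integral_cong_AE) measurable
qed

lift_definition scaleC_ltwo :: "complex \<Rightarrow> ltwo \<Rightarrow> ltwo"
  is "\<lambda>c f x. c * f x"
  unfolding ltwo_rel_def by (auto intro: square_integrable_scale)

instantiation ltwo :: real_inner
begin

lift_definition zero_ltwo :: ltwo is "\<lambda>_. 0"
  by (simp add: ltwo_rel_def square_integrable_zero)

lift_definition plus_ltwo :: "ltwo \<Rightarrow> ltwo \<Rightarrow> ltwo" is "\<lambda>f g x. f x + g x"
  unfolding ltwo_rel_def by (auto intro: square_integrable_add)

lift_definition minus_ltwo :: "ltwo \<Rightarrow> ltwo \<Rightarrow> ltwo" is "\<lambda>f g x. f x - g x"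
  unfolding ltwo_rel_def by (auto intro: square_integrable_diff)

lift_definition uminus_ltwo :: "ltwo \<Rightarrow> ltwo" is "\<lambda>f x. - f x"
  unfolding ltwo_rel_def by (auto intro: square_integrable_uminus)

definition scaleR_ltwo :: "real \<Rightarrow> ltwo \<Rightarrow> ltwo" where
  "scaleR_ltwo r = scaleC_ltwo (complex_of_real r)"

definition inner_ltwo :: "ltwo \<Rightarrow> ltwo \<Rightarrow> real" where
  "inner_ltwo f g = Re (cinner_ltwo f g)"

definition norm_ltwo :: "ltwo \<Rightarrow> real" where
  "norm_ltwo f = sqrt (f \<bullet> f)"

definition dist_ltwo :: "ltwo \<Rightarrow> ltwo \<Rightarrow> real" where
  "dist_ltwo f g = norm (f - g)"

definition sgn_ltwo :: "ltwo \<Rightarrow> ltwo" where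
  "sgn_ltwo f = inverse (norm f) *\<^sub>R f"

definition uniformity_ltwo :: "(ltwo \<times> ltwo) filter" where
  "uniformity_ltwo = (INF e\<in>{0 <..}. principal {(f, g). dist f g < e})"

definition open_ltwo :: "ltwo set \<Rightarrow> bool" where
  "open_ltwo U \<longleftrightarrow> (\<forall>f\<in>U. eventually (\<lambda>(f', g). f' = f \<longrightarrow> g \<in> U) uniformity)"

instance
proof
  fix f g h :: ltwo and r s :: real
  show "f + g + h = f + (g + h)"
    by transfer (auto simp: ltwo_rel_def add.assoc intro!: square_integrable_add)
  show "f + g = g + f"
    by transfer (auto simp: ltwo_rel_def add.commute intro!: square_integrable_add)
  show "0 + f = f"
    by transfer (auto simp: ltwo_rel_def)
  show "- f + f = 0"
    by transfer (auto simp: ltwo_rel_def square_integrable_zero)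
  show "f - g = f + - g"
    by transfer (auto simp: ltwo_rel_def intro!: square_integrable_diff)
  show "r *\<^sub>R (f + g) = r *\<^sub>R f + r *\<^sub>R g"
    unfolding scaleR_ltwo_def
    by transfer (auto simp: ltwo_rel_def distrib_left distrib_right
        intro!: square_integrable_add square_integrable_scale)
  show "(r + s) *\<^sub>R f = r *\<^sub>R f + s *\<^sub>R f"
    unfolding scaleR_ltwo_def
    by transfer (auto simp: ltwo_rel_def distrib_left distrib_right
        intro!: square_integrable_add square_integrable_scale)
  show "r *\<^sub>R s *\<^sub>R f = (r * s) *\<^sub>R f"
    unfolding scaleR_ltwo_def
    by transfer (auto simp: ltwo_rel_def mult.assoc intro!: square_integrable_scale)
  show "1 *\<^sub>R f = f"
    unfolding scaleR_ltwo_def by transfer (auto simp: ltwo_rel_def)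
  show "dist f g = norm (f - g)"
    by (rule dist_ltwo_def)
  show "sgn f = inverse (norm f) *\<^sub>R f"
    by (rule sgn_ltwo_def)
  show "uniformity = (INF e\<in>{0 <..}. principal {(f, g :: ltwo). dist f g < e})"
    by (rule uniformity_ltwo_def)
  show "open U \<longleftrightarrow> (\<forall>f\<in>U. \<forall>\<^sub>F (f', g) in uniformity. f' = f \<longrightarrow> g \<in> U)" for U :: "ltwo set"
    by (rule open_ltwo_def)
  show "norm f = sqrt (f \<bullet> f)"
    by (rule norm_ltwo_def)
  show "f \<bullet> g = g \<bullet> f"
    unfolding inner_ltwo_def
  proof transfer
    fix f g assume "ltwo_rel f f" "ltwo_rel g g"
    then have "integrable lborel (\<lambda>x. cnj (f x) * g x)" "integrable lborel (\<lambda>x. cnj (g x) * f x)"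
      by (simp_all add: ltwo_rel_def square_integrable_cnj_mult)
    then show "Re (\<integral>x. cnj (f x) * g x \<partial>lborel) = Re (\<integral>x. cnj (g x) * f x \<partial>lborel)"
      by (simp flip: integral_Re add: mult.commute)
  qed
  show "(f + g) \<bullet> h = f \<bullet> h + g \<bullet> h"
    unfolding inner_ltwo_def
    by transfer (simp add: ltwo_rel_def distrib_right square_integrable_cnj_mult)
  show "(r *\<^sub>R f) \<bullet> g = r * (f \<bullet> g)"
    unfolding inner_ltwo_def scaleR_ltwo_def
    by transfer (simp add: ltwo_rel_def mult.assoc square_integrable_cnj_mult)
  have *: "Re (\<integral>x. cnj (f x) * f x \<partial>lborel) = (\<integral>x. (cmod (f x))\<^sup>2 \<partial>lborel)" for f
  proof -
    have "cnj (f x) * f x = complex_of_real ((cmod (f x))\<^sup>2)" for x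
      by (metis complex_norm_square mult.commute)
    then show ?thesis
      by (simp only: integral_complex_of_real Re_complex_of_real)
  qed
  show "0 \<le> f \<bullet> f"
    unfolding inner_ltwo_def by transfer (simp add: *)
  show "f \<bullet> f = 0 \<longleftrightarrow> f = 0"
    unfolding inner_ltwo_def
  proof transfer
    fix f assume "ltwo_rel f f"
    then have "integrable lborel (\<lambda>x. (cmod (f x))\<^sup>2)" "square_integrable f"
      by (simp_all add: ltwo_rel_def square_integrable_def)
    then show "Re (\<integral>x. cnj (f x) * f x \<partial>lborel) = 0 \<longleftrightarrow> ltwo_rel f (\<lambda>_. 0)"
      by (simp add: * integral_nonneg_eq_0_iff_AE ltwo_rel_def square_integrable_zero)
  qed
qed

end

section \<open>Schwartz functions and ladder operators\<close>

definition fderiv :: "(real \<Rightarrow> complex) \<Rightarrow> real \<Rightarrow> complex" where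
  "fderiv f = (\<lambda>x. vector_derivative f (at x))"

definition schwartz :: "(real \<Rightarrow> complex) \<Rightarrow> bool" where
  "schwartz f \<longleftrightarrow>
     (\<forall>m x. (fderiv ^^ m) f differentiable (at x)) \<and>
     (\<forall>k m. bounded (range (\<lambda>x. x ^ k *\<^sub>R (fderiv ^^ m) f x)))"

definition annihilation :: "(real \<Rightarrow> complex) \<Rightarrow> real \<Rightarrow> complex" where
  "annihilation f = (\<lambda>x. complex_of_real (1 / sqrt 2) * (complex_of_real x * f x + fderiv f x))"

definition creation :: "(real \<Rightarrow> complex) \<Rightarrow> real \<Rightarrow> complex" where
  "creation f = (\<lambda>x. complex_of_real (1 / sqrt 2) * (complex_of_real x * f x - fderiv f x))"

lemma schwartz_square_integrable:
  assumes "schwartz f"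
  shows "square_integrable f"
proof -
  have "bounded (range (\<lambda>x. x ^ 0 *\<^sub>R (fderiv ^^ 0) f x))"
       "bounded (range (\<lambda>x. x ^ 1 *\<^sub>R (fderiv ^^ 0) f x))"
       "\<And>x. (fderiv ^^ 0) f differentiable (at x)"
    using assms unfolding schwartz_def by blast+
  then obtain B C where B: "\<And>x. cmod (f x) \<le> B" and C: "\<And>x. \<bar>x\<bar> * cmod (f x) \<le> C"
    and diff: "\<And>x. f differentiable (at x)"
    by (auto simp: bounded_iff)
  have "continuous_on UNIV f"
    by (simp add: continuous_at_imp_continuous_on differentiable_imp_continuous_within diff)
  then have [measurable]: "f \<in> borel_measurable borel"
    by (rule borel_measurable_continuous_onI)
  have "set_integrable lborel (einterval (-\<infinity>) \<infinity>) (\<lambda>x. 1 / (1 + x\<^sup>2) :: real)"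
  proof (rule interval_integral_FTC_nonneg)
    show "(arctan has_real_derivative 1 / (1 + x\<^sup>2)) (at x)" for x
      using DERIV_arctan[of x] by (simp add: inverse_eq_divide)
    show "isCont (\<lambda>x. 1 / (1 + x\<^sup>2) :: real) x" for x
      by (intro continuous_intros) (simp add: add_nonneg_eq_0_iff)
    show "((arctan \<circ> real_of_ereal) \<longlongrightarrow> - (pi / 2)) (at_right (-\<infinity>))"
      by (simp add: ereal_tendsto_simps tendsto_arctan_at_bot)
    show "((arctan \<circ> real_of_ereal) \<longlongrightarrow> pi / 2) (at_left \<infinity>)"
      by (simp add: ereal_tendsto_simps tendsto_arctan_at_top)
  qed simp_all
  then have "integrable lborel (\<lambda>x::real. 1 / (1 + x\<^sup>2))"
    by (simp add: set_integrable_def einterval_def)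
  then have int: "integrable lborel (\<lambda>x::real. (B\<^sup>2 + C\<^sup>2) * (1 / (1 + x\<^sup>2)))"
    by (rule integrable_mult_right)
  have bound: "(cmod (f x))\<^sup>2 \<le> (B\<^sup>2 + C\<^sup>2) * (1 / (1 + x\<^sup>2))" for x
  proof -
    have "(cmod (f x))\<^sup>2 \<le> B\<^sup>2"
      by (intro power_mono B) simp
    moreover have "(\<bar>x\<bar> * cmod (f x))\<^sup>2 \<le> C\<^sup>2"
      by (intro power_mono C) simp
    ultimately have "(cmod (f x))\<^sup>2 * (1 + x\<^sup>2) \<le> B\<^sup>2 + C\<^sup>2"
      by (simp add: power_mult_distrib algebra_simps)
    moreover have "0 < 1 + x\<^sup>2"
      by (simp add: add_pos_nonneg)
    ultimately show ?thesis
      by (simp add: pos_le_divide_eq)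
  qed
  have "integrable lborel (\<lambda>x. (cmod (f x))\<^sup>2)"
  proof (rule Bochner_Integration.integrable_bound[OF int])
    show "AE x in lborel. norm ((cmod (f x))\<^sup>2) \<le> norm ((B\<^sup>2 + C\<^sup>2) * (1 / (1 + x\<^sup>2)))"
      using bound by (intro always_eventually allI) (simp add: order.trans[OF _ abs_ge_self])
  qed measurable
  then show ?thesis
    by (simp add: square_integrable_def)
qed

text \<open>
  \<^term>\<open>abs_ltwo f\<close> is the class of \<open>f\<close>; it is only meaningful for square-integrable \<open>f\<close>.
  The eigenvectors are determined only up to phases, hence a predicate.
\<close>

definition number_eigenbasis :: "(nat \<Rightarrow> real \<Rightarrow> complex) \<Rightarrow> bool" where
  "number_eigenbasis \<phi> \<longleftrightarrow>
     (\<forall>n. schwartz (\<phi> n)) \<and>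
     (\<forall>n x. creation (annihilation (\<phi> n)) x = of_nat n * \<phi> n x) \<and>
     (\<forall>m n. cinner_ltwo (abs_ltwo (\<phi> m)) (abs_ltwo (\<phi> n)) = (if m = n then 1 else 0)) \<and>
     closure {\<Sum>k<N. scaleC_ltwo (c k) (abs_ltwo (\<phi> k)) | N c. True} = UNIV"

section \<open>Two-level system coupled to one mode\<close>

type_synonym spinor = "(real \<Rightarrow> complex) ^ 2"
type_synonym state = "ltwo ^ 2"

text \<open>
  The space \<open>\<complex>\<^sup>2 \<otimes> L\<^sup>2(\<real>)\<close> is represented by \<^typ>\<open>ltwo ^ 2\<close>, whose library norm is the
  Hilbert space norm of the direct sum of two copies of \<^typ>\<open>ltwo\<close>, and the algebraic tensor
  product of \<open>\<complex>\<^sup>2\<close> with the Schwartz space by the pairs of Schwartz functions.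
\<close>

definition tensor_vec :: "complex ^ 2 \<Rightarrow> (real \<Rightarrow> complex) \<Rightarrow> spinor"
  (infixr \<open>\<otimes>\<^sub>v\<close> 75) where
  "v \<otimes>\<^sub>v f = (\<chi> i. (\<lambda>x. v $ i * f x))"

definition tensor_op :: "complex ^ 2 ^ 2 \<Rightarrow> ((real \<Rightarrow> complex) \<Rightarrow> real \<Rightarrow> complex) \<Rightarrow>
    spinor \<Rightarrow> spinor"
  (infixr \<open>\<otimes>\<^sub>o\<close> 75) where
  "M \<otimes>\<^sub>o A = (\<lambda>F. \<chi> i. (\<lambda>x. \<Sum>j\<in>UNIV. M $ i $ j * A (F $ j) x))"

definition class_of :: "spinor \<Rightarrow> state" where
  "class_of F = (\<chi> i. abs_ltwo (F $ i))"

definition scaleC_state :: "complex \<Rightarrow> state \<Rightarrow> state" where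
  "scaleC_state c \<psi> = (\<chi> i. scaleC_ltwo c (\<psi> $ i))"

definition sigma_x :: "complex ^ 2 ^ 2" where
  "sigma_x = vector [vector [0, 1], vector [1, 0]]"

definition sigma_z :: "complex ^ 2 ^ 2" where
  "sigma_z = vector [vector [1, 0], vector [0, -1]]"

definition sigma_plus :: "complex ^ 2 ^ 2" where
  "sigma_plus = vector [vector [0, 1], vector [0, 0]]"

definition sigma_minus :: "complex ^ 2 ^ 2" where
  "sigma_minus = vector [vector [0, 0], vector [1, 0]]"

definition free_ham :: "real \<Rightarrow> spinor \<Rightarrow> spinor" where
  "free_ham \<omega> F = (\<chi> i. (\<lambda>x.
       complex_of_real (\<omega> / 2) * ((sigma_z \<otimes>\<^sub>o id) F $ i) x
     + complex_of_real \<omega> * ((mat 1 \<otimes>\<^sub>o (creation \<circ> annihilation)) F $ i) x))"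

definition rabi_ham :: "real \<Rightarrow> real \<Rightarrow> real \<Rightarrow> spinor \<Rightarrow> spinor"
  where
  "rabi_ham \<Omega> \<omega> lam F = (\<chi> i. (\<lambda>x.
       complex_of_real (\<Omega> / 2) * ((sigma_z \<otimes>\<^sub>o id) F $ i) x
     + complex_of_real \<omega> * ((mat 1 \<otimes>\<^sub>o (creation \<circ> annihilation)) F $ i) x
     + complex_of_real lam * ((sigma_x \<otimes>\<^sub>o (\<lambda>f y. annihilation f y + creation f y)) F $ i) x))"

definition rwa_ham :: "real \<Rightarrow> real \<Rightarrow> real \<Rightarrow> spinor \<Rightarrow> spinor"
  where
  "rwa_ham \<Omega> \<omega> lam F = (\<chi> i. (\<lambda>x.
       complex_of_real (\<Omega> / 2) * ((sigma_z \<otimes>\<^sub>o id) F $ i) x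
     + complex_of_real \<omega> * ((mat 1 \<otimes>\<^sub>o (creation \<circ> annihilation)) F $ i) x
     + complex_of_real lam * (((sigma_plus \<otimes>\<^sub>o annihilation) F $ i) x
                            + ((sigma_minus \<otimes>\<^sub>o creation) F $ i) x)))"

section \<open>Unbounded operators and their unitary groups\<close>

text \<open>Unbounded operators are represented by their graphs.\<close>

definition schwartz_graph ::
  "(spinor \<Rightarrow> spinor) \<Rightarrow> (state \<times> state) set" where
  "schwartz_graph T = {(class_of F, class_of (T F)) | F. \<forall>i. schwartz (F $ i)}"

definition closed_op ::
  "(spinor \<Rightarrow> spinor) \<Rightarrow> (state \<times> state) set" where
  "closed_op T = closure (schwartz_graph T)"

definition unitary_op :: "(state \<Rightarrow> state) \<Rightarrow> bool" where
  "unitary_op V \<longleftrightarrow>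
     (\<forall>\<psi> \<eta>. V (\<psi> + \<eta>) = V \<psi> + V \<eta>) \<and>
     (\<forall>c \<psi>. V (scaleC_state c \<psi>) = scaleC_state c (V \<psi>)) \<and>
     (\<forall>\<psi>. norm (V \<psi>) = norm \<psi>) \<and> surj V"

text \<open>
  \<open>exp_group A E\<close> states that \<open>E t = e\<^sup>i\<^sup>t\<^sup>A\<close> for all real \<open>t\<close>: \<open>E\<close> is a strongly continuous
  one-parameter unitary group, the domain of \<open>A\<close> consists of exactly those vectors whose orbit
  is differentiable at \<open>0\<close>, and the derivative there is \<open>i A \<psi>\<close>. By Stone's theorem such an \<open>E\<close>
  exists if and only if \<open>A\<close> is self-adjoint, and then it is unique.
\<close>

definition exp_group ::
  "(state \<times> state) set \<Rightarrow> (real \<Rightarrow> state \<Rightarrow> state) \<Rightarrow> bool" where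
  "exp_group A E \<longleftrightarrow>
     (\<forall>t. unitary_op (E t)) \<and>
     E 0 = id \<and>
     (\<forall>s t. E (s + t) = E s \<circ> E t) \<and>
     (\<forall>\<psi>. continuous_on UNIV (\<lambda>t. E t \<psi>)) \<and>
     (\<forall>\<psi> \<eta>. (\<psi>, \<eta>) \<in> A \<longleftrightarrow>
        ((\<lambda>t. E t \<psi>) has_vector_derivative scaleC_state \<i> \<eta>) (at 0))"

end

(*
  The evolution generated by H_0 is unitary and cancels, so the distance is
  D(t) = norm (exp(-it H_RWA) p - exp(-it H) p) for the Fock state p.  The rotating wave dynamics
  stays in a two-dimensional space spanned by p and its partner q, where it is a Rabi oscillation
  u(t).  The counter-rotating terms W = H - H_RWA send p and q to lam p' and lam q'.

  Upper bound: d/ds (exp(isH) u(s)) = i exp(isH) W u(s), and norm (W u(s)) <= lam sqrt(2 (n + 2)), so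
  D(t) <= lam t sqrt(2 (n + 2)); moreover pi sqrt 2 < 5.

  Lower bound: let c' be the diagonal energy of p', and chi(t) = exp(itH) p' up to the phase of c'.
  Then <chi(t), p> vanishes at 0, is at most norm p' * D(t), and its derivative is the overlap of
  (H - c') p' with exp(-itH) p, that is an explicit overlap with u(t), close to lam (norm p')^2, up to
  an error norm ((H - c') p') * D(t).  Integrating up to T = 1 / (3 lam norm p') bounds sup D from
  below.  If T > pi / omega, then g is so small that the claimed lower bound is not positive.
*)

theory Submission
  imports Defs
begin

section \<open>Schwartz functions and ladder operators\<close>

text \<open>Iterated derivatives never leave a class closed under \<open>fderiv\<close>, so decay
  has to be checked only for members of the class. This avoids Leibniz formulas for higher
  derivatives.\<close>

lemma schwartz_coinduct:
  assumes "P f"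
    and step: "\<And>h. P h \<Longrightarrow> (\<forall>x. h differentiable (at x)) \<and>
      (\<forall>k. bounded (range (\<lambda>x. x ^ k *\<^sub>R h x))) \<and> P (fderiv h)"
  shows "schwartz f"
proof -
  have "P ((fderiv ^^ m) f)" for m
    by (induction m) (use assms in auto)
  then show ?thesis
    unfolding schwartz_def using step by blast
qed

lemma schwartz_differentiable: "schwartz f \<Longrightarrow> f differentiable (at x)"
  unfolding schwartz_def by (metis funpow_0)

lemma schwartz_bounded: "schwartz f \<Longrightarrow> bounded (range (\<lambda>x. x ^ k *\<^sub>R f x))"
  unfolding schwartz_def by (metis funpow_0)

lemma schwartz_fderiv: "schwartz f \<Longrightarrow> schwartz (fderiv f)"
  unfolding schwartz_def by (metis funpow_Suc_right o_apply)

lemma schwartz_has_derivative: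
  "schwartz f \<Longrightarrow> (f has_vector_derivative fderiv f x) (at x)"
  unfolding fderiv_def by (simp add: schwartz_differentiable flip: vector_derivative_works)

lemma schwartz_continuous: "schwartz f \<Longrightarrow> isCont f x"
  by (simp add: differentiable_imp_continuous_within schwartz_differentiable)

lemma fderiv_eqI: "(\<And>x. (f has_vector_derivative f' x) (at x)) \<Longrightarrow> fderiv f = f'"
  unfolding fderiv_def by (auto intro!: vector_derivative_at)

lemma fderiv_lincomb:
  assumes "schwartz f" "schwartz g"
  shows "fderiv (\<lambda>x. c * f x + d * g x) = (\<lambda>x. c * fderiv f x + d * fderiv g x)"
  by (intro fderiv_eqI has_vector_derivative_add has_vector_derivative_mult_right
      schwartz_has_derivative assms)

lemma schwartz_lincomb:
  assumes "schwartz f" "schwartz g"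
  shows "schwartz (\<lambda>x. c * f x + d * g x)"
proof (rule schwartz_coinduct[where P = "\<lambda>h. \<exists>f g. schwartz f \<and> schwartz g \<and> h = (\<lambda>x. c * f x + d * g x)"])
  fix h :: "real \<Rightarrow> complex"
  assume "\<exists>f g. schwartz f \<and> schwartz g \<and> h = (\<lambda>x. c * f x + d * g x)"
  then obtain f g where fg: "schwartz f" "schwartz g" and h: "h = (\<lambda>x. c * f x + d * g x)"
    by blast
  have "h differentiable (at x)" for x
    unfolding h using fg schwartz_differentiable by (intro derivative_intros) auto
  moreover have "bounded (range (\<lambda>x. x ^ k *\<^sub>R h x))" for k
  proof -
    obtain B C where "\<And>x. norm (x ^ k *\<^sub>R f x) \<le> B" "\<And>x. norm (x ^ k *\<^sub>R g x) \<le> C"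
      using fg[THEN schwartz_bounded, of k] by (auto simp: bounded_iff)
    moreover have "x ^ k *\<^sub>R h x = c * (x ^ k *\<^sub>R f x) + d * (x ^ k *\<^sub>R g x)" for x
      unfolding h by (simp add: scaleR_conv_of_real algebra_simps)
    ultimately have "norm (x ^ k *\<^sub>R h x) \<le> norm c * B + norm d * C" for x
      by (metis add_mono mult_left_mono norm_ge_zero norm_mult norm_triangle_le)
    then show ?thesis
      by (auto simp: bounded_iff)
  qed
  moreover have "fderiv h = (\<lambda>x. c * fderiv f x + d * fderiv g x)"
    unfolding h using fg by (rule fderiv_lincomb)
  ultimately show "(\<forall>x. h differentiable (at x)) \<and> (\<forall>k. bounded (range (\<lambda>x. x ^ k *\<^sub>R h x))) \<and>
      (\<exists>f g. schwartz f \<and> schwartz g \<and> fderiv h = (\<lambda>x. c * f x + d * g x))"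
    using fg schwartz_fderiv by blast
qed (use assms in blast)

lemma has_vector_derivative_times_id:
  assumes "schwartz f"
  shows "((\<lambda>x. complex_of_real x * f x) has_vector_derivative
    (f x + complex_of_real x * fderiv f x)) (at x)"
proof -
  have "((\<lambda>x. complex_of_real x) has_vector_derivative 1) (at x)"
    using has_vector_derivative_of_real[of "\<lambda>x. x" 1 "at x"] by (simp flip: has_real_derivative_iff_has_vector_derivative)
  from has_vector_derivative_mult[OF this schwartz_has_derivative[OF assms]]
  show ?thesis by (simp add: add.commute)
qed

lemma schwartz_times_id:
  assumes "schwartz f"
  shows "schwartz (\<lambda>x. complex_of_real x * f x)"
\<comment> \<open>Products x f alone are not closed under differentiation: (x f + g)' = x f' + (f +
  g'). The summand g absorbs the lower-order term.\<close>
proof (rule schwartz_coinduct[where P = "\<lambda>h. \<exists>f g. schwartz f \<and> schwartz g \<and> h = (\<lambda>x. complex_of_real x * f x + g x)"])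
  show "\<exists>h g. schwartz h \<and> schwartz g \<and> (\<lambda>x. complex_of_real x * f x) = (\<lambda>x. complex_of_real x * h x + g x)"
    using assms schwartz_lincomb[OF assms assms, of 0 0]
    by (intro exI[of _ f] exI[of _ "\<lambda>_. 0"]) simp
  fix h :: "real \<Rightarrow> complex"
  assume "\<exists>f g. schwartz f \<and> schwartz g \<and> h = (\<lambda>x. complex_of_real x * f x + g x)"
  then obtain f g where fg: "schwartz f" "schwartz g" and h: "h = (\<lambda>x. complex_of_real x * f x + g x)"
    by blast
  have D: "(h has_vector_derivative f x + complex_of_real x * fderiv f x + fderiv g x) (at x)" for x
    unfolding h by (intro has_vector_derivative_add has_vector_derivative_times_id schwartz_has_derivative fg)
  have "bounded (range (\<lambda>x. x ^ k *\<^sub>R h x))" for k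
  proof -
    \<comment> \<open>The factor x costs one power of the decay of f, hence
      \<open>Suc k\<close>.\<close>
    obtain B C where "\<And>x. norm (x ^ Suc k *\<^sub>R f x) \<le> B" "\<And>x. norm (x ^ k *\<^sub>R g x) \<le> C"
      using fg(1)[THEN schwartz_bounded, of "Suc k"] fg(2)[THEN schwartz_bounded, of k]
      by (auto simp: bounded_iff simp del: power_Suc)
    moreover have "x ^ k *\<^sub>R h x = x ^ Suc k *\<^sub>R f x + x ^ k *\<^sub>R g x" for x
      unfolding h by (simp add: scaleR_conv_of_real algebra_simps)
    ultimately have "norm (x ^ k *\<^sub>R h x) \<le> B + C" for x
      by (metis add_mono norm_triangle_le)
    then show ?thesis
      by (auto simp: bounded_iff)
  qed
  moreover have "fderiv h = (\<lambda>x. complex_of_real x * fderiv f x + (1 * f x + 1 * fderiv g x))"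
    using fderiv_eqI[OF D] by (simp add: algebra_simps)
  ultimately show "(\<forall>x. h differentiable (at x)) \<and> (\<forall>k. bounded (range (\<lambda>x. x ^ k *\<^sub>R h x))) \<and>
      (\<exists>f g. schwartz f \<and> schwartz g \<and> fderiv h = (\<lambda>x. complex_of_real x * f x + g x))"
    using fg schwartz_fderiv schwartz_lincomb[OF fg(1) schwartz_fderiv[OF fg(2)], of 1 1] D
    by (auto intro!: differentiableI_vector)
qed

section \<open>Commutation relation and adjointness of the ladder operators\<close>

lemma schwartz_annihilation: "schwartz f \<Longrightarrow> schwartz (annihilation f)"
  using schwartz_lincomb[OF schwartz_times_id schwartz_fderiv, of f f "1 / sqrt 2" "1 / sqrt 2"]
  by (simp add: annihilation_def distrib_left)

lemma schwartz_creation: "schwartz f \<Longrightarrow> schwartz (creation f)"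
  using schwartz_lincomb[OF schwartz_times_id schwartz_fderiv, of f f "1 / sqrt 2" "- 1 / sqrt 2"]
  by (simp add: creation_def right_diff_distrib)

lemma annihilation_scale:
  "schwartz f \<Longrightarrow> annihilation (\<lambda>x. c * f x) = (\<lambda>x. c * annihilation f x)"
  using fderiv_lincomb[of f f c 0] by (simp add: annihilation_def algebra_simps fun_eq_iff)

lemma creation_scale:
  "schwartz f \<Longrightarrow> creation (\<lambda>x. c * f x) = (\<lambda>x. c * creation f x)"
  using fderiv_lincomb[of f f c 0] by (simp add: creation_def algebra_simps fun_eq_iff)

lemma fderiv_ladder:
  assumes "schwartz f"
  shows "fderiv (annihilation f) = (\<lambda>x. complex_of_real (1 / sqrt 2) *
      (f x + complex_of_real x * fderiv f x + fderiv (fderiv f) x))"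
    and "fderiv (creation f) = (\<lambda>x. complex_of_real (1 / sqrt 2) *
      (f x + complex_of_real x * fderiv f x - fderiv (fderiv f) x))"
  unfolding annihilation_def creation_def
  by (intro fderiv_eqI has_vector_derivative_mult_right has_vector_derivative_add
      has_vector_derivative_diff has_vector_derivative_times_id
      schwartz_has_derivative schwartz_fderiv assms)+

text \<open>Expanding the derivatives turns the two products into (x^2 f - f'')/2 plus, respectively
  minus, f/2.\<close>

lemma ladder_commutator:
  assumes "schwartz f"
  shows "annihilation (creation f) x = creation (annihilation f) x + f x"
proof -
  have "complex_of_real (sqrt 2) * complex_of_real (sqrt 2) = 2"
    by (metis of_real_mult of_real_numeral real_sqrt_mult_self abs_numeral)
  then show ?thesis
    unfolding annihilation_def[of "creation f"] creation_def[of "annihilation f"] fderiv_ladder[OF assms]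
    by (simp add: annihilation_def creation_def field_simps)
qed

lemma schwartz_integrable_cnj_mult:
  "schwartz f \<Longrightarrow> schwartz g \<Longrightarrow> integrable lborel (\<lambda>x. cnj (f x) * g x)"
  by (intro square_integrable_cnj_mult schwartz_square_integrable)

text \<open>Boundedness of x f(x) gives decay of order 1/|x|. These limits are the boundary terms of
  the integration by parts below.\<close>

lemma schwartz_vanishes:
  assumes "schwartz f"
  shows "(f \<longlongrightarrow> 0) at_top" "(f \<longlongrightarrow> 0) at_bot"
proof -
  obtain B where B: "\<And>x. norm (x ^ 1 *\<^sub>R f x) \<le> B"
    using schwartz_bounded[OF assms, of 1] by (auto simp: bounded_iff)
  have le: "norm (f x) \<le> B * \<bar>1 / x\<bar>" if "x \<noteq> 0" for x
    using B[of x] that by (simp add: field_simps)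
  have "((\<lambda>x. B * \<bar>1 / x\<bar>) \<longlongrightarrow> B * \<bar>0\<bar>) at_top" "((\<lambda>x. B * \<bar>1 / x\<bar>) \<longlongrightarrow> B * \<bar>0\<bar>) at_bot"
    by (intro tendsto_intros tendsto_divide_0[OF tendsto_const]
        filterlim_at_top_imp_at_infinity filterlim_at_bot_imp_at_infinity filterlim_ident)+
  then have lim: "((\<lambda>x. B * \<bar>1 / x\<bar>) \<longlongrightarrow> 0) at_top" "((\<lambda>x. B * \<bar>1 / x\<bar>) \<longlongrightarrow> 0) at_bot"
    by simp_all
  have "eventually (\<lambda>x. norm (f x) \<le> B * \<bar>1 / x\<bar>) at_top"
    using eventually_gt_at_top[of 0] by eventually_elim (rule le, simp)
  with lim(1) show "(f \<longlongrightarrow> 0) at_top"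
    by (rule Lim_null_comparison[rotated])
  have "eventually (\<lambda>x. norm (f x) \<le> B * \<bar>1 / x\<bar>) at_bot"
    using eventually_gt_at_bot[of 0] by eventually_elim (rule le, simp)
  with lim(2) show "(f \<longlongrightarrow> 0) at_bot"
    by (rule Lim_null_comparison[rotated])
qed

text \<open>The product of the conjugate of f with g is a primitive of an integrable function and
  vanishes at both ends of the line.\<close>

lemma schwartz_integral_by_parts:
  assumes f: "schwartz f" and g: "schwartz g"
  shows "(\<integral>x. cnj (fderiv f x) * g x \<partial>lborel) = - (\<integral>x. cnj (f x) * fderiv g x \<partial>lborel)"
proof -
  let ?h = "\<lambda>x. cnj (f x) * g x" and ?h' = "\<lambda>x. cnj (f x) * fderiv g x + cnj (fderiv f x) * g x"
  note int = schwartz_integrable_cnj_mult[OF f schwartz_fderiv[OF g]]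
    schwartz_integrable_cnj_mult[OF schwartz_fderiv[OF f] g]
  have lim: "(?h \<longlongrightarrow> 0) at_top" "(?h \<longlongrightarrow> 0) at_bot"
    using tendsto_mult[OF tendsto_cnj[OF schwartz_vanishes(1)[OF f]] schwartz_vanishes(1)[OF g]]
      tendsto_mult[OF tendsto_cnj[OF schwartz_vanishes(2)[OF f]] schwartz_vanishes(2)[OF g]]
    by simp_all
  have "(LBINT x=-\<infinity>..\<infinity>. ?h' x) = 0 - 0"
  proof (rule interval_integral_FTC_integrable[where F = ?h])
    show "(?h has_vector_derivative ?h' x) (at x)" for x
      by (intro has_vector_derivative_mult has_vector_derivative_cnj schwartz_has_derivative f g)
    show "isCont ?h' x" for x
      by (intro continuous_intros isCont_cnj schwartz_continuous schwartz_fderiv f g)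
    show "set_integrable lborel (einterval (- \<infinity>) \<infinity>) ?h'"
      using int by (simp add: set_integrable_def einterval_def)
    show "((?h \<circ> real_of_ereal) \<longlongrightarrow> 0) (at_right (-\<infinity>))"
      "((?h \<circ> real_of_ereal) \<longlongrightarrow> 0) (at_left \<infinity>)"
      using lim by (simp_all add: ereal_tendsto_simps)
  qed simp
  then have "(\<integral>x. ?h' x \<partial>lborel) = 0"
    by (simp add: interval_lebesgue_integral_def set_lebesgue_integral_def einterval_def)
  then show ?thesis
    using int by (simp add: add_eq_0_iff)
qed

lemma ltwo_rel_refl_schwartz: "schwartz f \<Longrightarrow> ltwo_rel f f"
  by (simp add: ltwo_rel_def schwartz_square_integrable)

lemma cinner_abs_ltwo:
  "schwartz f \<Longrightarrow> schwartz g \<Longrightarrow>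
    cinner_ltwo (abs_ltwo f) (abs_ltwo g) = (\<integral>x. cnj (f x) * g x \<partial>lborel)"
  by (intro cinner_ltwo.abs_eq ltwo_rel_refl_schwartz)

lemma abs_ltwo_lincomb:
  assumes "schwartz f" "schwartz g"
  shows "abs_ltwo (\<lambda>x. c * f x + d * g x) = scaleC_ltwo c (abs_ltwo f) + scaleC_ltwo d (abs_ltwo g)"
  by (simp add: scaleC_ltwo.abs_eq plus_ltwo.abs_eq ltwo_rel_refl_schwartz assms
      square_integrable_scale schwartz_square_integrable ltwo_rel_def)

text \<open>Multiplication by x is symmetric and differentiation is antisymmetric, so moving the
  operator across flips the sign of its derivative term.\<close>

lemma creation_adjoint:
  assumes f: "schwartz f" and g: "schwartz g"
  shows "cinner_ltwo (abs_ltwo f) (abs_ltwo (creation g)) =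
    cinner_ltwo (abs_ltwo (annihilation f)) (abs_ltwo g)"
proof -
  note int = schwartz_integrable_cnj_mult[OF f schwartz_times_id[OF g]]
    schwartz_integrable_cnj_mult[OF f schwartz_fderiv[OF g]]
    schwartz_integrable_cnj_mult[OF schwartz_fderiv[OF f] g]
  let ?s = "complex_of_real (1 / sqrt 2)"
  have "(\<integral>x. cnj (f x) * creation g x \<partial>lborel) =
      (\<integral>x. ?s * (cnj (f x) * (complex_of_real x * g x) - cnj (f x) * fderiv g x) \<partial>lborel)"
    by (simp add: creation_def algebra_simps)
  also have "\<dots> = ?s * ((\<integral>x. cnj (f x) * (complex_of_real x * g x) \<partial>lborel)
      + (\<integral>x. cnj (fderiv f x) * g x \<partial>lborel))"
    unfolding schwartz_integral_by_parts[OF f g] integral_mult_right_zero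
      Bochner_Integration.integral_diff[OF int(1,2)] by simp
  also have "\<dots> = (\<integral>x. ?s * (cnj (f x) * (complex_of_real x * g x) + cnj (fderiv f x) * g x) \<partial>lborel)"
    unfolding integral_mult_right_zero Bochner_Integration.integral_add[OF int(1,3)] by simp
  also have "\<dots> = (\<integral>x. cnj (annihilation f x) * g x \<partial>lborel)"
    by (simp add: annihilation_def algebra_simps)
  finally show ?thesis
    by (simp add: cinner_abs_ltwo schwartz_annihilation schwartz_creation f g)
qed

section \<open>The complex structure of the state space\<close>

lemma scaleC_ltwo_add: "scaleC_ltwo c (f + g) = scaleC_ltwo c f + scaleC_ltwo c g"
  by transfer (auto simp: ltwo_rel_def distrib_left
      intro!: square_integrable_add square_integrable_scale)

lemma scaleC_ltwo_add_left: "scaleC_ltwo (c + d) f = scaleC_ltwo c f + scaleC_ltwo d f"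
  by transfer (auto simp: ltwo_rel_def distrib_right
      intro!: square_integrable_add square_integrable_scale)

lemma scaleC_ltwo_scaleC_ltwo: "scaleC_ltwo c (scaleC_ltwo d f) = scaleC_ltwo (c * d) f"
  by transfer (auto simp: ltwo_rel_def mult.assoc intro!: square_integrable_scale)

lemma cinner_ltwo_scaleC_left: "cinner_ltwo (scaleC_ltwo c f) g = cnj c * cinner_ltwo f g"
  by transfer (simp add: mult.assoc)

lemma cinner_ltwo_scaleC_right: "cinner_ltwo f (scaleC_ltwo c g) = c * cinner_ltwo f g"
proof transfer
  fix f g :: "real \<Rightarrow> complex" and c
  have "(\<integral>x. cnj (f x) * (c * g x) \<partial>lborel) = (\<integral>x. c * (cnj (f x) * g x) \<partial>lborel)"
    by (simp only: ac_simps)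
  then show "(\<integral>x. cnj (f x) * (c * g x) \<partial>lborel) = c * (\<integral>x. cnj (f x) * g x \<partial>lborel)"
    by (simp only: integral_mult_right_zero)
qed

lemma cinner_ltwo_commute: "cinner_ltwo f g = cnj (cinner_ltwo g f)"
proof transfer
  fix f g :: "real \<Rightarrow> complex"
  have "cnj (\<integral>x. cnj (g x) * f x \<partial>lborel) = (\<integral>x. cnj (cnj (g x) * f x) \<partial>lborel)"
    by (rule Bochner_Integration.integral_cnj[symmetric])
  then show "(\<integral>x. cnj (f x) * g x \<partial>lborel) = cnj (\<integral>x. cnj (g x) * f x \<partial>lborel)"
    by (simp add: mult.commute)
qed

lemma scaleC_state_add: "scaleC_state c (x + y) = scaleC_state c x + scaleC_state c y"
  by (simp add: scaleC_state_def vec_eq_iff scaleC_ltwo_add)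

lemma scaleC_state_add_left: "scaleC_state (c + d) x = scaleC_state c x + scaleC_state d x"
  by (simp add: scaleC_state_def vec_eq_iff scaleC_ltwo_add_left)

lemma scaleC_state_scaleC_state: "scaleC_state c (scaleC_state d x) = scaleC_state (c * d) x"
  by (simp add: scaleC_state_def vec_eq_iff scaleC_ltwo_scaleC_ltwo)

lemma scaleC_state_of_real: "scaleC_state (complex_of_real r) x = r *\<^sub>R x"
  by (simp add: scaleC_state_def vec_eq_iff scaleR_ltwo_def)

lemma scaleC_state_0_left: "scaleC_state 0 x = 0"
  using scaleC_state_of_real[of 0 x] by simp

lemma scaleC_state_1: "scaleC_state 1 x = x"
  using scaleC_state_of_real[of 1 x] by simp

lemma scaleC_state_scaleR: "scaleC_state c (r *\<^sub>R x) = scaleC_state (c * complex_of_real r) x"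
  by (simp add: scaleC_state_scaleC_state flip: scaleC_state_of_real)

text \<open>\<open>inner\<close> is only the real part of the complex inner product, so complex
  scalars cannot be pulled out of it. Collecting them in the first slot, where they act
  conjugate-linearly, replaces this in all later phase computations.\<close>

lemma inner_scaleC_state:
  "inner (scaleC_state c x) (scaleC_state d y) = inner (scaleC_state (cnj d * c) x) y"
  by (simp add: inner_vec_def scaleC_state_def inner_ltwo_def cinner_ltwo_scaleC_left
      cinner_ltwo_scaleC_right ac_simps)

lemma norm_scaleC_state: "norm (scaleC_state c x) = norm c * norm x"
proof -
  have "(norm (scaleC_state c x))\<^sup>2 = inner (scaleC_state (complex_of_real ((norm c)\<^sup>2)) x) x"
    by (simp only: power2_norm_eq_inner[of "scaleC_state c x"] inner_scaleC_state
        complex_norm_square mult.commute[of c])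
  also have "\<dots> = (norm c * norm x)\<^sup>2"
    by (simp only: scaleC_state_of_real inner_scaleR_left power2_norm_eq_inner power_mult_distrib)
  finally show ?thesis
    by (simp add: power2_eq_iff_nonneg)
qed

lemma inner_scaleC_state_self: "inner (scaleC_state c x) x = Re c * (norm x)\<^sup>2"
proof -
  have "Im (cinner_ltwo f f) = 0" for f
    using cinner_ltwo_commute[of f f] by (simp add: complex_eq_iff)
  then show ?thesis
    by (simp add: inner_vec_def scaleC_state_def inner_ltwo_def cinner_ltwo_scaleC_left
        power2_norm_eq_inner sum_distrib_left)
qed

text \<open>Provides the product rule for a complex scalar curve times a curve of states.\<close>

lemma bounded_bilinear_scaleC_state: "bounded_bilinear scaleC_state"
proof
  show "scaleC_state (r *\<^sub>R c) x = r *\<^sub>R scaleC_state c x" for r c x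
    by (simp add: scaleR_conv_of_real scaleC_state_scaleC_state flip: scaleC_state_of_real)
  show "scaleC_state c (r *\<^sub>R x) = r *\<^sub>R scaleC_state c x" for r c x
    by (simp add: scaleC_state_scaleC_state mult.commute flip: scaleC_state_of_real)
  show "\<exists>K. \<forall>c x. norm (scaleC_state c x) \<le> norm c * norm x * K"
    by (rule exI[of _ 1]) (simp add: norm_scaleC_state)
qed (fact scaleC_state_add scaleC_state_add_left)+

text \<open>The real inner product sees only the real part; letting \<open>w\<close> range over all
  complex scalars forces the full complex inner product to vanish.\<close>

definition corthogonal :: "state \<Rightarrow> state \<Rightarrow> bool" where
  "corthogonal x y \<longleftrightarrow> (\<forall>w. inner (scaleC_state w x) y = 0)"

lemma corthogonalD: "corthogonal x y \<Longrightarrow> inner (scaleC_state c x) (scaleC_state d y) = 0"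
  by (simp add: corthogonal_def inner_scaleC_state)

lemma corthogonal_inner: "corthogonal x y \<Longrightarrow> inner x y = 0"
  unfolding corthogonal_def by (metis scaleC_state_1)

section \<open>Unitary groups\<close>

context
  fixes A E
  assumes grp: "exp_group A E"
begin

lemma exp_group_unitary: "unitary_op (E t)"
  using grp by (simp add: exp_group_def)

lemma exp_group_zero [simp]: "E 0 x = x"
  using grp by (simp add: exp_group_def)

lemma exp_group_add: "E (s + t) x = E s (E t x)"
  using grp by (simp add: exp_group_def)

lemma exp_group_inverse [simp]: "E t (E (- t) x) = x" "E (- t) (E t x) = x"
  using exp_group_add[of t "- t" x] exp_group_add[of "- t" t x] by simp_all

lemma exp_group_plus: "E t (x + y) = E t x + E t y"
  using exp_group_unitary[of t] by (simp add: unitary_op_def)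

lemma exp_group_scaleC: "E t (scaleC_state c x) = scaleC_state c (E t x)"
  using exp_group_unitary[of t] by (simp add: unitary_op_def)

lemma exp_group_norm: "norm (E t x) = norm x"
  using exp_group_unitary[of t] by (simp add: unitary_op_def)

lemma exp_group_bounded_linear: "bounded_linear (E t)"
  by (rule bounded_linear_intro[where K = 1])
    (simp_all add: exp_group_plus exp_group_norm exp_group_scaleC flip: scaleC_state_of_real)

lemma exp_group_diff: "E t (x - y) = E t x - E t y"
  using exp_group_bounded_linear[of t] by (simp add: bounded_linear.linear linear_diff)

lemma exp_group_inner: "inner (E t x) (E t y) = inner x y"
  by (simp add: dot_norm exp_group_norm flip: exp_group_plus)

lemma exp_group_adjoint: "inner (E t x) y = inner x (E (- t) y)"
  using exp_group_inner[of t x "E (- t) y"] by simp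

text \<open>\<open>exp_group\<close> speaks about the derivative at 0 only. The group law writes the
  orbit near t as \<open>E t\<close> applied to the orbit near 0, and \<open>E t\<close> is bounded
  and linear.\<close>

lemma exp_group_orbit:
  assumes "(x, y) \<in> A"
  shows "((\<lambda>t. E t x) has_vector_derivative E t (scaleC_state \<i> y)) (at t)"
proof -
  have 0: "((\<lambda>s. E s x) has_vector_derivative scaleC_state \<i> y) (at (t - t))"
    using grp assms by (simp add: exp_group_def)
  have "((\<lambda>s. s - t) has_vector_derivative 1) (at t)"
    by (auto intro!: derivative_eq_intros)
  from vector_diff_chain_at[OF this 0]
  have "((\<lambda>s. E (s - t) x) has_vector_derivative scaleC_state \<i> y) (at t)"
    by (simp add: o_def)
  from bounded_linear.has_vector_derivative[OF exp_group_bounded_linear this, of t]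
  show ?thesis
    by (simp flip: exp_group_add)
qed

lemma exp_group_moving_orbit:
  assumes "(x, y) \<in> A" and "(c has_vector_derivative c') (at t)"
  shows "((\<lambda>t. E t (scaleC_state (c t) x)) has_vector_derivative
    E t (scaleC_state c' x + scaleC_state (\<i> * c t) y)) (at t)"
  using bounded_bilinear.has_vector_derivative[OF bounded_bilinear_scaleC_state
      assms(2) exp_group_orbit[OF assms(1), of t]]
  by (simp add: exp_group_scaleC exp_group_plus scaleC_state_scaleC_state ac_simps)

end

section \<open>A resonant doublet perturbed by counter-rotating terms\<close>

lemma has_vector_derivative_cis:
  "((\<lambda>t. cis (a * t + b)) has_vector_derivative \<i> * complex_of_real a * cis (a * t + b)) (at t)"
  unfolding has_vector_derivative_def
  by (auto intro!: derivative_eq_intros simp: fun_eq_iff scaleR_conv_of_real algebra_simps)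

lemma has_vector_derivative_complex_of_real:
  assumes "(f has_real_derivative f') (at t)"
  shows "((\<lambda>t. complex_of_real (f t)) has_vector_derivative complex_of_real f') (at t)"
  using assms by (intro has_vector_derivative_of_real)
    (simp flip: has_real_derivative_iff_has_vector_derivative)

lemma cos_ge_quadratic: "cos x \<ge> 1 - x\<^sup>2 / 2" for x :: real
proof -
  have "cos x = 1 - 2 * (sin (x / 2))\<^sup>2"
    using cos_double_sin[of "x / 2"] by simp
  moreover have "(sin (x / 2))\<^sup>2 \<le> (x / 2)\<^sup>2"
    unfolding abs_le_square_iff[symmetric] by (rule abs_sin_x_le_abs_x)
  ultimately show ?thesis
    by (simp add: power_divide)
qed

text \<open>Passing to a sum of cosines makes the bound valid for all x and y; multiplying two
  quadratic lower bounds would need a discussion of signs.\<close>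

lemma cos_mult_cos_ge: "cos x * cos y \<ge> 1 - (x\<^sup>2 + y\<^sup>2) / 2" for x y :: real
proof -
  have "cos x * cos y = (cos (x - y) + cos (x + y)) / 2"
    by (simp add: cos_times_cos)
  moreover have "(x - y)\<^sup>2 + (x + y)\<^sup>2 = 2 * (x\<^sup>2 + y\<^sup>2)"
    by (simp add: power2_eq_square algebra_simps)
  ultimately show ?thesis
    using cos_ge_quadratic[of "x - y"] cos_ge_quadratic[of "x + y"] by argo
qed

text \<open>Treats both spin states at once. A and B stand for the full and the RWA Hamiltonian, p
  for the Fock state, q for its RWA partner, p' and q' for their counter-rotating images (without
  the factor lam), and r for the other vector that A reaches from p'. Resonance gives p and q the
  same diagonal energy c. The vectors other than p stay unnormalised, so the matrix elements are
  lam, lam * \<kappa> and lam * \<nu>; in the applications \<kappa> and \<nu> are the squared norms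
  of q and p'.\<close>

locale perturbed_doublet =
  fixes A B :: "(state \<times> state) set" and E R :: "real \<Rightarrow> state \<Rightarrow> state"
    and p q p' q' r :: state and c c' lam \<kappa> \<nu> M :: real
  assumes E: "exp_group A E" and R: "exp_group B R"
    and lam: "lam > 0" and \<kappa>: "\<kappa> > 0" and \<nu>: "\<nu> > 0"
    and Bp: "(p, c *\<^sub>R p + lam *\<^sub>R q) \<in> B"
    and Bq: "(q, c *\<^sub>R q + (lam * \<kappa>) *\<^sub>R p) \<in> B"
    and Ap: "(p, c *\<^sub>R p + lam *\<^sub>R q + lam *\<^sub>R p') \<in> A"
    and Aq: "(q, c *\<^sub>R q + (lam * \<kappa>) *\<^sub>R p + lam *\<^sub>R q') \<in> A"
    and Ap': "(p', c' *\<^sub>R p' + (lam * \<nu>) *\<^sub>R p + lam *\<^sub>R r) \<in> A"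
    and norm_p: "norm p = 1"
    and norm_p': "norm p' = sqrt \<nu>"
    and norm_r: "(norm r)\<^sup>2 \<le> \<nu> * (\<nu> + 1)"
    and p'_le: "norm p' \<le> M" and q'_le: "norm q' \<le> sqrt \<kappa> * M"
    and orth: "corthogonal p q" "corthogonal p' p" "corthogonal p' q" "corthogonal r p"
      "corthogonal r q"
begin

section \<open>The Rabi oscillation of the unperturbed doublet\<close>

definition \<Theta> :: real where "\<Theta> = lam * sqrt \<kappa>"

text \<open>\<open>\<alpha>\<close> and \<open>\<beta>\<close> are the amplitudes of p and q. Their
  frequency \<open>\<Theta>\<close> is the geometric mean of the couplings lam and lam * \<kappa>,
  and the division by sqrt \<kappa> in \<open>\<beta>\<close> compensates for the unnormalised q.
  The summand 0 in the phase matches the shape of \<open>has_vector_derivative_cis\<close>.\<close>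

definition \<alpha> :: "real \<Rightarrow> complex" where
  "\<alpha> t = cis (- c * t + 0) * complex_of_real (cos (\<Theta> * t))"

definition \<beta> :: "real \<Rightarrow> complex" where
  "\<beta> t = cis (- c * t + 0) * complex_of_real (sin (\<Theta> * t) / sqrt \<kappa>) * (- \<i>)"

definition u :: "real \<Rightarrow> state" where
  "u t = scaleC_state (\<alpha> t) p + scaleC_state (\<beta> t) q"

lemma u_zero [simp]: "u 0 = p"
  by (simp add: u_def \<alpha>_def \<beta>_def scaleC_state_0_left scaleC_state_1)

text \<open>Together with \<open>deriv_\<beta>\<close> this is the Schroedinger equation of the RWA
  Hamiltonian in the coordinates of p and q.\<close>

lemma deriv_\<alpha>: "(\<alpha> has_vector_derivative
    - \<i> * complex_of_real c * \<alpha> t - \<i> * complex_of_real (lam * \<kappa>) * \<beta> t) (at t)"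
proof -
  have "((\<lambda>t. cos (\<Theta> * t)) has_real_derivative - \<Theta> * sin (\<Theta> * t)) (at t)"
    by (auto intro!: derivative_eq_intros)
  note D = has_vector_derivative_mult[OF has_vector_derivative_cis[of "- c" 0 t]
      has_vector_derivative_complex_of_real[OF this]]
  have *: "complex_of_real (lam * \<kappa>) * complex_of_real (sin (\<Theta> * t) / sqrt \<kappa>)
      = complex_of_real (\<Theta> * sin (\<Theta> * t))"
    unfolding of_real_mult[symmetric] of_real_eq_iff using \<kappa> by (simp add: \<Theta>_def field_simps)
  have "- \<i> * complex_of_real (lam * \<kappa>) * \<beta> t
      = - (cis (- c * t + 0) * complex_of_real (\<Theta> * sin (\<Theta> * t)))"
    unfolding \<beta>_def *[symmetric] by (simp add: algebra_simps)
  then have "- \<i> * complex_of_real c * \<alpha> t - \<i> * complex_of_real (lam * \<kappa>) * \<beta> t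
    = cis (- c * t + 0) * complex_of_real (- \<Theta> * sin (\<Theta> * t))
      + \<i> * complex_of_real (- c) * cis (- c * t + 0) * complex_of_real (cos (\<Theta> * t))"
    unfolding \<alpha>_def by (simp add: algebra_simps)
  with D show ?thesis
    unfolding \<alpha>_def[abs_def] by metis
qed

lemma deriv_\<beta>: "(\<beta> has_vector_derivative
    - \<i> * complex_of_real c * \<beta> t - \<i> * complex_of_real lam * \<alpha> t) (at t)"
proof -
  have "((\<lambda>t. sin (\<Theta> * t) / sqrt \<kappa>) has_real_derivative lam * cos (\<Theta> * t)) (at t)"
    using \<kappa> by (auto intro!: derivative_eq_intros simp: \<Theta>_def field_simps)
  note D = has_vector_derivative_mult_left[OF has_vector_derivative_mult[OF
      has_vector_derivative_cis[of "- c" 0 t] has_vector_derivative_complex_of_real[OF this]], of "- \<i>"]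
  show ?thesis
    unfolding \<beta>_def[abs_def] \<alpha>_def
    by (rule has_vector_derivative_eq_rhs[OF D]) (simp add: algebra_simps)
qed

text \<open>The amplitude equations cancel the doublet part of the generator, so only the surplus x,
  y drives the motion. It serves twice: with x = y = 0 for R, and with the counter-rotating images
  for E.\<close>

lemma deriv_u:
  assumes S: "exp_group C S" and "(p, c *\<^sub>R p + lam *\<^sub>R q + x) \<in> C"
    and "(q, c *\<^sub>R q + (lam * \<kappa>) *\<^sub>R p + y) \<in> C"
  shows "((\<lambda>t. S t (u t)) has_vector_derivative
    S t (scaleC_state (\<i> * \<alpha> t) x + scaleC_state (\<i> * \<beta> t) y)) (at t)"
proof -
  let ?a = "- \<i> * complex_of_real c * \<alpha> t - \<i> * complex_of_real (lam * \<kappa>) * \<beta> t"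
  let ?b = "- \<i> * complex_of_real c * \<beta> t - \<i> * complex_of_real lam * \<alpha> t"
  let ?v = "(scaleC_state ?a p + scaleC_state (\<i> * \<alpha> t) (c *\<^sub>R p + lam *\<^sub>R q + x))
    + (scaleC_state ?b q + scaleC_state (\<i> * \<beta> t) (c *\<^sub>R q + (lam * \<kappa>) *\<^sub>R p + y))"
  have "((\<lambda>t. S t (u t)) has_vector_derivative S t ?v) (at t)"
    unfolding u_def exp_group_plus[OF S, of _ "scaleC_state (\<alpha> _) p"]
      exp_group_plus[OF S, of t "scaleC_state _ p + _" "scaleC_state _ q + _"]
    by (rule has_vector_derivative_add[OF exp_group_moving_orbit[OF S assms(2) deriv_\<alpha>]
          exp_group_moving_orbit[OF S assms(3) deriv_\<beta>]])
  moreover have "?v = scaleC_state (?a + \<i> * \<alpha> t * complex_of_real c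
        + \<i> * \<beta> t * complex_of_real (lam * \<kappa>)) p
      + scaleC_state (?b + \<i> * \<alpha> t * complex_of_real lam + \<i> * \<beta> t * complex_of_real c) q
      + (scaleC_state (\<i> * \<alpha> t) x + scaleC_state (\<i> * \<beta> t) y)"
    by (simp only: scaleC_state_add scaleC_state_scaleR scaleC_state_add_left add_ac)
  moreover have "?a + \<i> * \<alpha> t * complex_of_real c + \<i> * \<beta> t * complex_of_real (lam * \<kappa>) = 0"
    "?b + \<i> * \<alpha> t * complex_of_real lam + \<i> * \<beta> t * complex_of_real c = 0"
    by (simp_all add: algebra_simps)
  ultimately show ?thesis
    by (simp only: scaleC_state_0_left add_0_left)
qed

text \<open>\<open>R t (u t)\<close> has zero derivative and starts at p; undoing \<open>R t\<close>
  identifies u as the RWA orbit.\<close>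

lemma rwa_orbit: "R (- t) p = u t"
proof -
  have "((\<lambda>t. R t (u t)) has_vector_derivative 0) (at t)" for t
    using deriv_u[OF R, of 0 0 t] Bp Bq R bounded_bilinear.zero_right[OF bounded_bilinear_scaleC_state]
    by (simp add: linear_0 bounded_linear.linear exp_group_bounded_linear)
  then have "(\<lambda>t. R t (u t)) t = (\<lambda>t. R t (u t)) 0"
    by (intro has_derivative_zero_unique_connected[of UNIV])
      (auto simp: has_vector_derivative_def)
  then have "R t (u t) = p"
    using R by simp
  then show ?thesis
    by (metis exp_group_inverse(2)[OF R])
qed

section \<open>Upper bound for the deviation\<close>

lemma norm_alpha_beta: "norm (\<alpha> t) = \<bar>cos (\<Theta> * t)\<bar>" "norm (\<beta> t) * sqrt \<kappa> = \<bar>sin (\<Theta> * t)\<bar>"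
  using \<kappa> by (simp_all add: \<alpha>_def \<beta>_def norm_mult norm_divide)

lemma deviation_le:
  assumes "t \<ge> 0"
  shows "norm (R (- t) p - E (- t) p) \<le> lam * sqrt 2 * M * t"
proof (cases "t = 0")
  case False
  let ?v = "\<lambda>s. scaleC_state (\<i> * \<alpha> s) (lam *\<^sub>R p') + scaleC_state (\<i> * \<beta> s) (lam *\<^sub>R q')"
  note D = deriv_u[OF E Ap Aq]
  have bound: "norm (E s (?v s)) \<le> lam * sqrt 2 * M" for s
  proof -
    \<comment> \<open>Source of the factor sqrt 2: the two amplitudes are estimated jointly, by
      expanding the square of the difference of their moduli.\<close>
    have "\<bar>cos (\<Theta> * s)\<bar> + \<bar>sin (\<Theta> * s)\<bar> \<le> sqrt 2"
    proof (rule real_le_rsqrt)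
      have "0 \<le> (\<bar>cos (\<Theta> * s)\<bar> - \<bar>sin (\<Theta> * s)\<bar>)\<^sup>2"
        by simp
      then show "(\<bar>cos (\<Theta> * s)\<bar> + \<bar>sin (\<Theta> * s)\<bar>)\<^sup>2 \<le> 2"
        using sin_cos_squared_add[of "\<Theta> * s"] by (simp add: power2_sum power2_diff)
    qed
    moreover have M: "0 \<le> M"
      using p'_le norm_ge_zero order_trans by blast
    ultimately have *: "lam * (\<bar>cos (\<Theta> * s)\<bar> + \<bar>sin (\<Theta> * s)\<bar>) * M \<le> lam * sqrt 2 * M"
      using lam by (intro mult_right_mono mult_left_mono) auto
    have "norm (E s (?v s)) \<le> lam * norm (\<alpha> s) * norm p' + lam * norm (\<beta> s) * norm q'"
      unfolding exp_group_norm[OF E]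
      using lam by (intro order_trans[OF norm_triangle_ineq])
        (simp add: norm_scaleC_state norm_mult ac_simps)
    \<comment> \<open>The factor sqrt \<kappa> in the bound on q' cancels the one dividing
      \<open>\<beta>\<close>, so p' and q' contribute the same M.\<close>
    also have "\<dots> \<le> lam * norm (\<alpha> s) * M + lam * norm (\<beta> s) * (sqrt \<kappa> * M)"
      using lam p'_le q'_le by (intro add_mono mult_left_mono) auto
    also have "\<dots> = lam * (\<bar>cos (\<Theta> * s)\<bar> + \<bar>sin (\<Theta> * s)\<bar>) * M"
      unfolding norm_alpha_beta[symmetric] by (simp add: algebra_simps)
    finally show ?thesis
      using * by linarith
  qed
  have "continuous_on {0..t} (\<lambda>t. E t (u t))"
    using D by (meson continuous_at_imp_continuous_on has_vector_derivative_continuous)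
  with False assms obtain s where
    "norm (E t (u t) - E 0 (u 0)) \<le> norm ((t - 0) *\<^sub>R E s (?v s))"
    using mvt_general[of 0 t "\<lambda>t. E t (u t)" "\<lambda>s h. h *\<^sub>R E s (?v s)"] D
    unfolding has_vector_derivative_def by auto
  also have "\<dots> \<le> t * (lam * sqrt 2 * M)"
    using assms bound[of s] by (simp only: norm_scaleR diff_zero abs_of_nonneg) (intro mult_left_mono)
  \<comment> \<open>Unitarity of \<open>E t\<close> turns the distance travelled from p into the
    deviation itself.\<close>
  also have "E t (u t) - E 0 (u 0) = E t (R (- t) p - E (- t) p)"
    using E by (simp add: rwa_orbit exp_group_diff)
  finally show ?thesis
    by (simp add: exp_group_norm[OF E] ac_simps)
qed (use E R in simp)

text \<open>
  The test vector is the counter-rotating partner \<open>p'\<close> of \<open>p\<close>, moved by \<open>E\<close> with its diagonal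
  energy \<open>c'\<close> removed; the extra phase makes the gain oscillate symmetrically about \<open>T / 2\<close>.
\<close>

lemma deviation_ge:
  assumes T: "T \<ge> 0" and d: "\<And>t. 0 \<le> t \<Longrightarrow> t \<le> T \<Longrightarrow> norm (R (- t) p - E (- t) p) \<le> d"
  shows "lam * \<nu> * (T - (c' - c)\<^sup>2 * T ^ 3 / 24 - lam\<^sup>2 * \<kappa> * T ^ 3 / 6)
    \<le> sqrt \<nu> * d * (1 + lam * T * sqrt (2 * \<nu> + 1))"
proof -
  \<comment> \<open>The factor -\<i> cancels the \<i> of the evolution equation, so that the gain
    below is a product of cosines.\<close>
  define z where "z t = cis (- c' * t + (c' - c) * T / 2) * (- \<i>)" for t
  define F where "F t = inner (E t (scaleC_state (z t) p')) p" for t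
  define w where "w t = scaleC_state (\<i> * z t * complex_of_real lam) (\<nu> *\<^sub>R p + r)" for t
  have z': "(z has_vector_derivative - \<i> * complex_of_real c' * z t) (at t)" for t
    unfolding z_def[abs_def]
    by (rule has_vector_derivative_eq_rhs[OF has_vector_derivative_mult_left[OF has_vector_derivative_cis]])
      (simp add: algebra_simps)
  have dnn: "0 \<le> d"
    using d[of 0] T norm_ge_zero order_trans by blast
  have norm_z: "norm (z t) = 1" for t
    by (simp add: z_def norm_mult)
  \<comment> \<open>The rotation of z removes the diagonal term c' p'; what is left of A p' is lam
    (\<nu> p + r), and the group moves over to p.\<close>
  have D: "(F has_real_derivative inner (w t) (E (- t) p)) (at t)" for t
  proof -
    have "scaleC_state (- \<i> * complex_of_real c' * z t) p'
        + scaleC_state (\<i> * z t) (c' *\<^sub>R p' + (lam * \<nu>) *\<^sub>R p + lam *\<^sub>R r)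
        = scaleC_state (- \<i> * complex_of_real c' * z t + \<i> * z t * complex_of_real c') p'
        + scaleC_state (\<i> * z t * complex_of_real (lam * \<nu>)) p
        + scaleC_state (\<i> * z t * complex_of_real lam) r"
      by (simp only: scaleC_state_add scaleC_state_scaleR scaleC_state_add_left ac_simps)
    also have "\<dots> = scaleC_state 0 p' + scaleC_state (\<i> * z t * complex_of_real (lam * \<nu>)) p
        + scaleC_state (\<i> * z t * complex_of_real lam) r"
      by (intro arg_cong2[where f = "(+)"] arg_cong2[where f = scaleC_state] refl)
        (simp_all add: algebra_simps)
    also have "\<dots> = w t"
      by (simp add: w_def scaleC_state_0_left scaleC_state_add scaleC_state_scaleR ac_simps)
    finally have "((\<lambda>t. E t (scaleC_state (z t) p')) has_vector_derivative E t (w t)) (at t)"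
      using exp_group_moving_orbit[OF E Ap' z'[of t]] by simp
    from bounded_linear.has_vector_derivative[OF bounded_linear_inner_left this, of p]
    show ?thesis
      by (simp add: F_def[abs_def] has_real_derivative_iff_has_vector_derivative exp_group_adjoint[OF E])
  qed
  \<comment> \<open>Since r is orthogonal to the unit vector p, the squared norms add up to at most
    \<nu>^2 + \<nu> (\<nu> + 1).\<close>
  have norm_w: "norm (w t) \<le> lam * (sqrt \<nu> * sqrt (2 * \<nu> + 1))" for t
  proof -
    have "(norm (\<nu> *\<^sub>R p + r))\<^sup>2 = \<nu>\<^sup>2 + (norm r)\<^sup>2"
      using norm_p corthogonal_inner[OF orth(4)]
      by (simp add: power2_norm_eq_inner inner_add_left inner_add_right inner_commute[of p r]
          norm_eq_1 power2_eq_square[of \<nu>])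
    also have "\<dots> \<le> \<nu> * (2 * \<nu> + 1)"
      using norm_r by (simp add: power2_eq_square algebra_simps)
    finally have "norm (\<nu> *\<^sub>R p + r) \<le> sqrt (\<nu> * (2 * \<nu> + 1))"
      by (rule real_le_rsqrt)
    then show ?thesis
      using lam by (simp add: w_def norm_scaleC_state norm_mult norm_z real_sqrt_mult)
  qed
  \<comment> \<open>With the RWA orbit in place of the exact one, orthogonality leaves only the
    overlap of p with itself.\<close>
  have gain: "inner (w t) (u t) = lam * \<nu> * (cos ((c' - c) * (t - T / 2)) * cos (\<Theta> * t))" for t
  proof -
    have "inner (w t) (u t) = inner (scaleC_state (\<i> * z t * complex_of_real (lam * \<nu>)) p) (scaleC_state (\<alpha> t) p)"
      using orth by (simp add: w_def u_def scaleC_state_add scaleC_state_scaleR inner_add_left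
          inner_add_right corthogonalD mult.assoc)
    also have "\<dots> = inner (scaleC_state (cnj (\<alpha> t) * (\<i> * z t * complex_of_real (lam * \<nu>))) p) p"
      by (rule inner_scaleC_state)
    also have "\<dots> = Re (cnj (\<alpha> t) * (\<i> * z t * complex_of_real (lam * \<nu>)))"
      using norm_p by (simp add: inner_scaleC_state_self)
    also have "cnj (\<alpha> t) * (\<i> * z t * complex_of_real (lam * \<nu>)) =
        complex_of_real (lam * \<nu> * cos (\<Theta> * t)) * cis (- ((c' - c) * (t - T / 2)))"
    proof -
      let ?X = "cis (c * t)" and ?Y = "cis (- c' * t + (c' - c) * T / 2)"
      have \<alpha>: "cnj (\<alpha> t) = ?X * complex_of_real (cos (\<Theta> * t))"
        by (simp add: \<alpha>_def cis_cnj)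
      have z: "\<i> * z t = ?Y"
        by (simp add: z_def mult.left_commute[of \<i>])
      have XY: "?X * ?Y = cis (- ((c' - c) * (t - T / 2)))"
        unfolding cis_mult by (rule arg_cong[where f = cis]) (simp add: field_simps)
      show ?thesis
        unfolding \<alpha> z XY[symmetric] of_real_mult by (simp only: ac_simps)
    qed
    finally show ?thesis
      by simp
  qed
  define K where "K = lam * (sqrt \<nu> * sqrt (2 * \<nu> + 1)) * d"
  \<comment> \<open>F minus a primitive of the lower bound for F': quadratic cosine bounds for the
    gain, less the error rate K caused by replacing \<open>E (- t) p\<close> with
    \<open>u t\<close>. The first cubic is centred at T / 2, like the phase.\<close>
  define G where "G t = F t - (lam * \<nu> * (t - (c' - c)\<^sup>2 * (t - T / 2) ^ 3 / 6 - \<Theta>\<^sup>2 * t ^ 3 / 6) - K * t)" for t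
  have "G 0 \<le> G T"
  proof (rule DERIV_nonneg_imp_nondecreasing[OF T], intro exI conjI)
    fix t assume t: "0 \<le> t" "t \<le> T"
    let ?g = "lam * \<nu> * (1 - (c' - c)\<^sup>2 * (t - T / 2)\<^sup>2 / 2 - \<Theta>\<^sup>2 * t\<^sup>2 / 2)"
    show "(G has_real_derivative inner (w t) (E (- t) p) - (?g - K)) (at t)"
      unfolding G_def[abs_def]
      by (rule derivative_eq_intros D refl | simp)+
    have "inner (w t) (u t - E (- t) p) \<le> norm (w t) * norm (u t - E (- t) p)"
      by (rule norm_cauchy_schwarz)
    also have "\<dots> \<le> K"
      unfolding K_def using lam \<nu> norm_w d[OF t] by (intro mult_mono) (auto simp: rwa_orbit)
    finally have "inner (w t) (u t) - K \<le> inner (w t) (E (- t) p)"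
      by (simp add: inner_diff_right)
    moreover have "1 - (c' - c)\<^sup>2 * (t - T / 2)\<^sup>2 / 2 - \<Theta>\<^sup>2 * t\<^sup>2 / 2
        \<le> cos ((c' - c) * (t - T / 2)) * cos (\<Theta> * t)"
      using cos_mult_cos_ge[of "(c' - c) * (t - T / 2)" "\<Theta> * t"]
      by (simp only: power_mult_distrib add_divide_distrib diff_diff_eq)
    then have "?g \<le> inner (w t) (u t)"
      unfolding gain using lam \<nu> by (intro mult_left_mono) auto
    ultimately show "0 \<le> inner (w t) (E (- t) p) - (?g - K)"
      by simp
  qed
  moreover have "F 0 = 0"
    using E orth(2) by (simp add: F_def corthogonal_def)
  moreover have "F T \<le> sqrt \<nu> * d"
  proof -
    \<comment> \<open>The RWA orbit never meets p', so its overlap can be subtracted for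
      free.\<close>
    have "F T = - inner (scaleC_state (z T) p') (u T - E (- T) p)"
      using orth(2,3) by (simp add: F_def exp_group_adjoint[OF E] u_def inner_diff_right
          inner_add_right corthogonalD)
    also have "\<dots> \<le> norm (scaleC_state (z T) p') * norm (u T - E (- T) p)"
      using Cauchy_Schwarz_ineq2[of "scaleC_state (z T) p'" "u T - E (- T) p"] by linarith
    also have "\<dots> \<le> sqrt \<nu> * d"
      using d[OF T order_refl] \<nu> norm_p'
      by (simp add: norm_scaleC_state norm_z rwa_orbit mult_left_mono)
    finally show ?thesis .
  qed
  moreover have "\<Theta>\<^sup>2 = lam\<^sup>2 * \<kappa>"
    using \<kappa> by (simp add: \<Theta>_def power_mult_distrib)
  \<comment> \<open>The centred cubic contributes (T / 2)^3 / 6 at each end, T^3 / 24 in total, a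
    quarter of the uncentred value.\<close>
  ultimately have "0 \<le> sqrt \<nu> * d - (lam * \<nu> * (T - (c' - c)\<^sup>2 * (T / 2) ^ 3 / 6 - lam\<^sup>2 * \<kappa> * T ^ 3 / 6) - K * T)
      + lam * \<nu> * ((c' - c)\<^sup>2 * (T / 2) ^ 3 / 6)"
    by (simp add: G_def)
  then show ?thesis
    by (simp add: K_def power_divide algebra_simps)
qed

end

section \<open>From the integrated estimate to the stated constants\<close>

lemma deviation_bound_arith:
  fixes lam \<omega> g \<kappa> \<nu> d T :: real
  assumes pos: "lam > 0" "\<omega> > 0" "g = lam / \<omega>" and n: "1 \<le> n" "n \<le> \<nu>" and \<kappa>: "\<kappa> \<le> 2 * \<nu>"
    and d: "d \<ge> 0" and T: "T = 1 / (3 * lam * sqrt \<nu>)"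
    and ge: "lam * \<nu> * (T - (2 * \<omega>)\<^sup>2 * T ^ 3 / 24 - lam\<^sup>2 * \<kappa> * T ^ 3 / 6)
      \<le> sqrt \<nu> * d * (1 + lam * T * sqrt (2 * \<nu> + 1))"
  shows "1 / 6 - 1 / (216 * g\<^sup>2 * n) - 7 / (12 * n) \<le> d"
proof -
  \<comment> \<open>Isolates the numerics: (1/3 - 2/162) / 1.58 exceeds 1/6, and (4/3) / 1.58 is
    below 1.\<close>
  have arith: "1 / 6 - X - Z \<le> d"
    if "1 / 3 - Y - K / 162 \<le> d * (79 / 50)" "Y \<le> 4 / 3 * X" "K \<le> 2" "0 \<le> X" "0 \<le> Z" "0 \<le> d"
    for X Y Z K
    using that by linarith
  define s where "s = sqrt \<nu>"
  have s: "s > 0" "\<nu> = s\<^sup>2"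
    using n by (simp_all add: s_def)
  have g: "g > 0" "\<omega> = lam / g"
    using pos by simp_all
  have T': "T = 1 / (3 * lam * s)"
    by (simp add: T s_def)
  \<comment> \<open>As \<nu> \<ge> 1, 2 \<nu> + 1 is at most 3 \<nu>, and 1.74^2 > 3. The choice of
    T makes lam * T * s equal to 1/3, whence 0.58 and the factor 79/50.\<close>
  have "sqrt (2 * \<nu> + 1) \<le> 1.74 * s"
  proof (rule real_le_lsqrt)
    show "2 * \<nu> + 1 \<le> (1.74 * s)\<^sup>2"
      using n s by (simp add: power_mult_distrib power_divide)
  qed (use s in auto)
  then have "lam * T * sqrt (2 * \<nu> + 1) \<le> 0.58"
    using pos s by (simp add: T' field_simps)
  then have le: "sqrt \<nu> * d * (1 + lam * T * sqrt (2 * \<nu> + 1)) \<le> s * d * (79 / 50)"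
    using s d unfolding s_def[symmetric] by (intro mult_left_mono) auto
  \<comment> \<open>Everything depends on T through lam * T = 1 / (3 s); the cube yields 1 / (27 s),
    and 27 * 6 = 162.\<close>
  have eq: "lam * \<nu> * (T - (2 * \<omega>)\<^sup>2 * T ^ 3 / 24 - lam\<^sup>2 * \<kappa> * T ^ 3 / 6)
      = s * (1 / 3 - 1 / (162 * g\<^sup>2 * \<nu>) - \<kappa> / \<nu> / 162)"
  proof -
    have 1: "lam * \<nu> * (T - (2 * \<omega>)\<^sup>2 * T ^ 3 / 24 - lam\<^sup>2 * \<kappa> * T ^ 3 / 6)
        = \<nu> * (lam * T) - \<nu> * (lam * T) ^ 3 / g\<^sup>2 / 6 - \<kappa> * (\<nu> * (lam * T) ^ 3) / 6"
      unfolding g(2) by (simp add: power_divide power2_eq_square power3_eq_cube algebra_simps)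
    have 2: "\<nu> * (lam * T) = s / 3" "\<nu> * (lam * T) ^ 3 = 1 / (27 * s)"
      unfolding T' s(2) using pos(1) s(1) by (simp_all add: power2_eq_square power3_eq_cube)
    have 3: "s / \<nu> = 1 / s"
      using s by (simp add: power2_eq_square)
    have 4: "s * (1 / 3 - 1 / (162 * g\<^sup>2 * \<nu>) - \<kappa> / \<nu> / 162)
        = s / 3 - (s / \<nu>) / g\<^sup>2 / 162 - \<kappa> * (s / \<nu>) / 162"
      by (simp add: right_diff_distrib mult.commute)
    show ?thesis
      unfolding 1 2 4 3 by simp
  qed
  have "s * (1 / 3 - 1 / (162 * g\<^sup>2 * \<nu>) - \<kappa> / \<nu> / 162) \<le> s * (d * (79 / 50))"
    using order_trans[OF ge le] unfolding eq mult.assoc[of s d] .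
  then have "1 / 3 - 1 / (162 * g\<^sup>2 * \<nu>) - \<kappa> / \<nu> / 162 \<le> d * (79 / 50)"
    by (rule mult_left_le_imp_le[OF _ s(1)])
  moreover have "1 / (162 * g\<^sup>2 * \<nu>) \<le> 4 / 3 * (1 / (216 * g\<^sup>2 * n))"
  proof -
    have "1 / (162 * g\<^sup>2 * \<nu>) \<le> 1 / (162 * g\<^sup>2 * n)"
      using n g by (intro divide_left_mono mult_left_mono) auto
    also have "\<dots> = 4 / 3 * (1 / (216 * g\<^sup>2 * n))"
      by simp
    finally show ?thesis .
  qed
  moreover have "\<kappa> / \<nu> \<le> 2"
    using \<kappa> n by (simp add: field_simps)
  moreover have "0 \<le> 1 / (216 * g\<^sup>2 * n)" "0 \<le> 7 / (12 * n)"
    using n by simp_all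
  ultimately show ?thesis
    using d by (rule arith)
qed

text \<open>The energy gap c' - c is -2 \<omega> for spin up and 2 \<omega> for spin down; stating
  its square covers both. Likewise n \<le> \<nu> and \<kappa> \<le> 2 * \<nu> cover \<nu> = n and
  \<nu> = n + 1.\<close>

lemma (in perturbed_doublet) sup_deviation_bounds:
  fixes \<omega> g n :: real
  assumes E0: "exp_group A0 E0" and \<omega>: "\<omega> > 0" and g: "g = lam / \<omega>"
    and n: "1 \<le> n" "n \<le> \<nu>" and \<kappa>_le: "\<kappa> \<le> 2 * \<nu>" and M: "M = sqrt (n + 2)"
    and detuning: "(c' - c)\<^sup>2 = (2 * \<omega>)\<^sup>2"
    and U1: "\<And>t. U1 t = E0 t \<circ> E (- t)" and U2: "\<And>t. U2 t = E0 t \<circ> R (- t)"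
  shows "5 * g * sqrt (n + 3) \<ge> (SUP t\<in>{0..pi / \<omega>}. norm (U2 t p - U1 t p))"
    and "(SUP t\<in>{0..pi / \<omega>}. norm (U2 t p - U1 t p)) \<ge> 1 / 6 - 1 / (216 * g\<^sup>2 * n) - 7 / (12 * n)"
proof -
  let ?D = "\<lambda>t. norm (U2 t p - U1 t p)"
  have D: "?D t = norm (R (- t) p - E (- t) p)" for t
    by (simp add: U1 U2 exp_group_norm[OF E0] flip: exp_group_diff[OF E0])
  have bound: "?D t \<le> 5 * g * sqrt (n + 3)" if t: "t \<in> {0..pi / \<omega>}" for t
  proof -
    have "pi * sqrt 2 \<le> 3.15 * 1.5"
      using pi_approx by (intro mult_mono real_le_lsqrt) (auto simp: power2_eq_square)
    then have pi5: "pi * sqrt 2 \<le> 5"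
      by simp
    have "?D t \<le> lam * sqrt 2 * M * t"
      unfolding D using t by (intro deviation_le) auto
    also have "\<dots> \<le> lam * sqrt 2 * M * (pi / \<omega>)"
      using t lam M n by (intro mult_left_mono) auto
    also have "\<dots> = g * (pi * sqrt 2) * sqrt (n + 2)"
      by (simp add: g M)
    also have "\<dots> \<le> g * 5 * sqrt (n + 3)"
      using pi5 lam \<omega> n g by (intro mult_mono mult_left_mono) auto
    finally show ?thesis
      by (simp add: mult.commute)
  qed
  have ne: "{0..pi / \<omega>} \<noteq> {}"
    using \<omega> by simp
  show "(SUP t\<in>{0..pi / \<omega>}. ?D t) \<le> 5 * g * sqrt (n + 3)"
    by (rule cSUP_least[OF ne bound])
  have "bdd_above (?D ` {0..pi / \<omega>})"
    by (rule bdd_aboveI2[OF bound])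
  then have le_sup: "?D t \<le> (SUP t\<in>{0..pi / \<omega>}. ?D t)" if "t \<in> {0..pi / \<omega>}" for t
    using that by (intro cSUP_upper)
  then have sup_nonneg: "0 \<le> (SUP t\<in>{0..pi / \<omega>}. ?D t)"
    using \<omega> by (intro order_trans[OF norm_ge_zero le_sup[of 0]]) auto
  define T where "T = 1 / (3 * lam * sqrt \<nu>)"
  show "1 / 6 - 1 / (216 * g\<^sup>2 * n) - 7 / (12 * n) \<le> (SUP t\<in>{0..pi / \<omega>}. ?D t)"
  proof (cases "T \<le> pi / \<omega>")
    case True
    have "lam * \<nu> * (T - (c' - c)\<^sup>2 * T ^ 3 / 24 - lam\<^sup>2 * \<kappa> * T ^ 3 / 6)
        \<le> sqrt \<nu> * (SUP t\<in>{0..pi / \<omega>}. ?D t) * (1 + lam * T * sqrt (2 * \<nu> + 1))"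
      using True lam \<nu> le_sup unfolding D by (intro deviation_ge) (auto simp: T_def)
    then show ?thesis
      unfolding detuning by (rule deviation_bound_arith[OF lam \<omega> g n \<kappa>_le sup_nonneg T_def])
  next
    case False
    \<comment> \<open>The crude bound pi \<ge> 2 is enough: then 6 g sqrt \<nu> < 1, and the term 1
      / (216 g^2 n) alone is at least 1/6.\<close>
    have "2 / \<omega> \<le> pi / \<omega>"
      using \<omega> pi_ge_two by (intro divide_right_mono) auto
    then have "2 / \<omega> < T"
      using False by linarith
    then have "6 * (g * sqrt \<nu>) < 1"
      using lam \<omega> \<nu> by (simp add: T_def g field_simps)
    then have "(6 * (g * sqrt \<nu>))\<^sup>2 \<le> 1\<^sup>2"
      using lam \<omega> \<nu> g by (intro power_mono) auto
    then have "36 * (g\<^sup>2 * \<nu>) \<le> 1"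
      using \<nu> by (simp add: power_mult_distrib)
    moreover have "g\<^sup>2 * n \<le> g\<^sup>2 * \<nu>"
      using n by (intro mult_left_mono) auto
    ultimately have "216 * g\<^sup>2 * n \<le> 6"
      by linarith
    moreover have "0 < 216 * g\<^sup>2 * n"
      using n lam \<omega> g by simp
    ultimately have "1 / 6 \<le> 1 / (216 * g\<^sup>2 * n)"
      by (intro divide_left_mono) auto
    moreover have "0 \<le> 7 / (12 * n)"
      using n by simp
    ultimately show ?thesis
      using sup_nonneg by linarith
  qed
qed

section \<open>Eigenfunctions of the number operator\<close>

text \<open>Neither normalised nor required to be nonzero, and with real \<mu>: lowering twice from
  n = 1 gives a null vector with formal eigenvalue -1, which needs no separate case.\<close>

definition number_eigenfunction :: "real \<Rightarrow> (real \<Rightarrow> complex) \<Rightarrow> bool" where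
  "number_eigenfunction \<mu> f \<longleftrightarrow>
     schwartz f \<and> creation (annihilation f) = (\<lambda>x. complex_of_real \<mu> * f x)"

lemma annihilation_creation_eigenfunction:
  "number_eigenfunction \<mu> f \<Longrightarrow>
    annihilation (creation f) = (\<lambda>x. complex_of_real (\<mu> + 1) * f x)"
  by (simp add: number_eigenfunction_def ladder_commutator fun_eq_iff distrib_right)

lemma number_eigenfunction_annihilation:
  assumes "number_eigenfunction \<mu> f"
  shows "number_eigenfunction (\<mu> - 1) (annihilation f)"
proof -
  have f: "schwartz f" and eig: "creation (annihilation f) = (\<lambda>x. complex_of_real \<mu> * f x)"
    using assms by (simp_all add: number_eigenfunction_def)
  have "creation (annihilation (annihilation f)) x = complex_of_real (\<mu> - 1) * annihilation f x" for x
    using ladder_commutator[OF schwartz_annihilation[OF f], of x]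
    unfolding eig annihilation_scale[OF f] by (simp add: left_diff_distrib)
  then show ?thesis
    by (simp add: number_eigenfunction_def schwartz_annihilation f fun_eq_iff)
qed

lemma number_eigenfunction_creation:
  assumes "number_eigenfunction \<mu> f"
  shows "number_eigenfunction (\<mu> + 1) (creation f)"
proof -
  have f: "schwartz f"
    using assms by (simp add: number_eigenfunction_def)
  show ?thesis
    unfolding number_eigenfunction_def annihilation_creation_eigenfunction[OF assms]
    using f by (simp only: creation_scale schwartz_creation simp_thms)
qed

lemma abs_ltwo_scale: "schwartz f \<Longrightarrow> abs_ltwo (\<lambda>x. c * f x) = scaleC_ltwo c (abs_ltwo f)"
  by (simp add: scaleC_ltwo.abs_eq ltwo_rel_refl_schwartz)

lemma abs_ltwo_scale_real:
  "schwartz f \<Longrightarrow> abs_ltwo (\<lambda>x. complex_of_real c * f x) = c *\<^sub>R abs_ltwo f"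
  by (simp add: abs_ltwo_scale scaleR_ltwo_def)

text \<open>Adjointness moves one ladder operator across the inner product, where the number
  operator acts by its eigenvalue.\<close>

lemma norm_annihilation_eigenfunction:
  assumes "number_eigenfunction \<mu> f"
  shows "(norm (abs_ltwo (annihilation f)))\<^sup>2 = \<mu> * (norm (abs_ltwo f))\<^sup>2"
proof -
  have f: "schwartz f" and eig: "creation (annihilation f) = (\<lambda>x. complex_of_real \<mu> * f x)"
    using assms by (simp_all add: number_eigenfunction_def)
  show ?thesis
    using creation_adjoint[OF f schwartz_annihilation[OF f], symmetric]
    by (simp add: power2_norm_eq_inner inner_ltwo_def eig abs_ltwo_scale f cinner_ltwo_scaleC_right)
qed

lemma norm_creation_eigenfunction:
  assumes "number_eigenfunction \<mu> f"
  shows "(norm (abs_ltwo (creation f)))\<^sup>2 = (\<mu> + 1) * (norm (abs_ltwo f))\<^sup>2"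
proof -
  have f: "schwartz f"
    using assms by (simp add: number_eigenfunction_def)
  show ?thesis
    using creation_adjoint[OF schwartz_creation[OF f] f]
    by (simp add: power2_norm_eq_inner inner_ltwo_def annihilation_creation_eigenfunction[OF assms]
        abs_ltwo_scale f cinner_ltwo_scaleC_left del: of_real_add)
qed

text \<open>The number operator is symmetric by adjointness applied twice, and the eigenvalues are
  real and distinct.\<close>

lemma number_eigenfunctions_orthogonal:
  assumes f: "number_eigenfunction \<mu> f" and g: "number_eigenfunction \<mu>' g" and "\<mu> \<noteq> \<mu>'"
  shows "cinner_ltwo (abs_ltwo f) (abs_ltwo g) = 0"
proof -
  have sw: "schwartz f" "schwartz g"
    using f g by (simp_all add: number_eigenfunction_def)
  let ?N = "\<lambda>h. abs_ltwo (creation (annihilation h))"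
  have N: "?N f = scaleC_ltwo (complex_of_real \<mu>) (abs_ltwo f)"
    "?N g = scaleC_ltwo (complex_of_real \<mu>') (abs_ltwo g)"
    using f g sw by (simp_all add: number_eigenfunction_def abs_ltwo_scale)
  have "cinner_ltwo (abs_ltwo f) (?N g) = cinner_ltwo (?N f) (abs_ltwo g)"
    using creation_adjoint[OF sw(1) schwartz_annihilation[OF sw(2)]]
      creation_adjoint[OF sw(2) schwartz_annihilation[OF sw(1)]]
    by (metis cinner_ltwo_commute)
  then show ?thesis
    using \<open>\<mu> \<noteq> \<mu>'\<close> by (simp add: N cinner_ltwo_scaleC_left cinner_ltwo_scaleC_right)
qed

section \<open>The Hamiltonians on product states\<close>

lemma class_of_tensor_axis: "class_of (axis j 1 \<otimes>\<^sub>v f) = axis j (abs_ltwo f)"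
  by (simp add: class_of_def tensor_vec_def vec_eq_iff axis_def zero_ltwo_def)

lemma norm_axis: "norm (axis j x) = norm x" for x :: ltwo
  by (simp add: norm_eq_sqrt_inner inner_axis_axis)

lemma scaleR_axis: "c *\<^sub>R axis j x = axis j (c *\<^sub>R x)" for x :: ltwo
  by (simp add: vec_eq_iff axis_def)

lemma scaleC_ltwo_0: "scaleC_ltwo c 0 = 0"
  by transfer (simp add: ltwo_rel_def square_integrable_zero)

lemma scaleC_state_axis: "scaleC_state c (axis j x) = axis j (scaleC_ltwo c x)"
  by (simp add: scaleC_state_def vec_eq_iff axis_def scaleC_ltwo_0)

lemma corthogonal_axis:
  "i \<noteq> j \<or> cinner_ltwo x y = 0 \<Longrightarrow> corthogonal (axis i x) (axis j y)"
  by (auto simp: corthogonal_def scaleC_state_axis inner_axis_axis inner_ltwo_def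
      cinner_ltwo_scaleC_left)

lemma annihilation_zero: "annihilation (\<lambda>x. 0) = (\<lambda>x. 0)"
  and creation_zero: "creation (\<lambda>x. 0) = (\<lambda>x. 0)"
  by (simp_all add: annihilation_def creation_def fderiv_def)

lemma schwartz_zero: "schwartz (\<lambda>x. 0)"
  unfolding schwartz_def
proof -
  have "(fderiv ^^ m) (\<lambda>x. 0) = (\<lambda>x. 0)" for m
    by (induction m) (simp_all add: fderiv_def)
  then show "(\<forall>m x. (fderiv ^^ m) (\<lambda>x. 0) differentiable (at x)) \<and>
      (\<forall>k m. bounded (range (\<lambda>x. x ^ k *\<^sub>R (fderiv ^^ m) (\<lambda>x. 0) x)))"
    by simp
qed

text \<open>Product vectors with a Schwartz factor already lie in the graph before closure, so no
  limit is taken. The other spin component is the zero function.\<close>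

lemma closed_op_tensor_axis:
  assumes "schwartz f" and "class_of (H (axis j 1 \<otimes>\<^sub>v f)) = y"
  shows "(axis j (abs_ltwo f), y) \<in> closed_op H"
proof -
  have "schwartz ((axis j 1 \<otimes>\<^sub>v f) $ i)" for i
    using assms(1) schwartz_zero by (simp add: tensor_vec_def axis_def)
  then have "(class_of (axis j 1 \<otimes>\<^sub>v f), class_of (H (axis j 1 \<otimes>\<^sub>v f))) \<in> schwartz_graph H"
    unfolding schwartz_graph_def by blast
  then show ?thesis
    using closure_subset unfolding closed_op_def class_of_tensor_axis assms(2) by blast
qed

lemmas ham_simps = tensor_op_def tensor_vec_def sigma_x_def sigma_z_def sigma_plus_def
  sigma_minus_def mat_def axis_def UNIV_2 annihilation_zero creation_zero

section \<open>Action of both Hamiltonians on spin-up and spin-down product states\<close>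

lemma rwa_ham_up:
  assumes "number_eigenfunction \<mu> f"
  shows "(axis 1 (abs_ltwo f), (\<omega> / 2 + \<omega> * \<mu>) *\<^sub>R axis 1 (abs_ltwo f)
      + lam *\<^sub>R axis 2 (abs_ltwo (creation f))) \<in> closed_op (rwa_ham \<omega> \<omega> lam)"
proof (rule closed_op_tensor_axis)
  have f: "schwartz f" and eig: "creation (annihilation f) = (\<lambda>x. complex_of_real \<mu> * f x)"
    using assms by (simp_all add: number_eigenfunction_def)
  show "schwartz f" by fact
  have "rwa_ham \<omega> \<omega> lam (axis 1 1 \<otimes>\<^sub>v f) = (\<chi> i. if i = 1
      then (\<lambda>x. complex_of_real (\<omega> / 2 + \<omega> * \<mu>) * f x) else (\<lambda>x. complex_of_real lam * creation f x))"
    by (simp add: rwa_ham_def ham_simps eig vec_eq_iff forall_2 fun_eq_iff algebra_simps)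
  then show "class_of (rwa_ham \<omega> \<omega> lam (axis 1 1 \<otimes>\<^sub>v f)) =
      (\<omega> / 2 + \<omega> * \<mu>) *\<^sub>R axis 1 (abs_ltwo f) + lam *\<^sub>R axis 2 (abs_ltwo (creation f))"
    by (simp add: class_of_def vec_eq_iff forall_2 axis_def abs_ltwo_scale_real schwartz_creation f
        del: of_real_add of_real_mult of_real_divide)
qed

lemma rwa_ham_down:
  assumes "number_eigenfunction \<mu> f"
  shows "(axis 2 (abs_ltwo f), (- \<omega> / 2 + \<omega> * \<mu>) *\<^sub>R axis 2 (abs_ltwo f)
      + lam *\<^sub>R axis 1 (abs_ltwo (annihilation f))) \<in> closed_op (rwa_ham \<omega> \<omega> lam)"
proof (rule closed_op_tensor_axis)
  have f: "schwartz f" and eig: "creation (annihilation f) = (\<lambda>x. complex_of_real \<mu> * f x)"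
    using assms by (simp_all add: number_eigenfunction_def)
  show "schwartz f" by fact
  have "rwa_ham \<omega> \<omega> lam (axis 2 1 \<otimes>\<^sub>v f) = (\<chi> i. if i = 1
      then (\<lambda>x. complex_of_real lam * annihilation f x)
      else (\<lambda>x. complex_of_real (- \<omega> / 2 + \<omega> * \<mu>) * f x))"
    by (simp add: rwa_ham_def ham_simps eig vec_eq_iff forall_2 fun_eq_iff algebra_simps)
  then show "class_of (rwa_ham \<omega> \<omega> lam (axis 2 1 \<otimes>\<^sub>v f)) =
      (- \<omega> / 2 + \<omega> * \<mu>) *\<^sub>R axis 2 (abs_ltwo f) + lam *\<^sub>R axis 1 (abs_ltwo (annihilation f))"
    by (simp add: class_of_def vec_eq_iff forall_2 axis_def abs_ltwo_scale_real schwartz_annihilation f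
        del: of_real_add of_real_mult of_real_divide of_real_minus of_real_diff)
qed

text \<open>\<open>sigma_x\<close> also flips the spin while lowering the mode; this
  counter-rotating term stands last, as the locale expects.\<close>

lemma rabi_ham_up:
  assumes "number_eigenfunction \<mu> f"
  shows "(axis 1 (abs_ltwo f), (\<omega> / 2 + \<omega> * \<mu>) *\<^sub>R axis 1 (abs_ltwo f)
      + lam *\<^sub>R axis 2 (abs_ltwo (creation f)) + lam *\<^sub>R axis 2 (abs_ltwo (annihilation f)))
    \<in> closed_op (rabi_ham \<omega> \<omega> lam)"
proof (rule closed_op_tensor_axis)
  have f: "schwartz f" and eig: "creation (annihilation f) = (\<lambda>x. complex_of_real \<mu> * f x)"
    using assms by (simp_all add: number_eigenfunction_def)
  show "schwartz f" by fact
  have "rabi_ham \<omega> \<omega> lam (axis 1 1 \<otimes>\<^sub>v f) = (\<chi> i. if i = 1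
      then (\<lambda>x. complex_of_real (\<omega> / 2 + \<omega> * \<mu>) * f x)
      else (\<lambda>x. complex_of_real lam * creation f x + complex_of_real lam * annihilation f x))"
    by (simp add: rabi_ham_def ham_simps eig vec_eq_iff forall_2 fun_eq_iff algebra_simps)
  then show "class_of (rabi_ham \<omega> \<omega> lam (axis 1 1 \<otimes>\<^sub>v f)) =
      (\<omega> / 2 + \<omega> * \<mu>) *\<^sub>R axis 1 (abs_ltwo f) + lam *\<^sub>R axis 2 (abs_ltwo (creation f))
      + lam *\<^sub>R axis 2 (abs_ltwo (annihilation f))"
    by (simp add: class_of_def vec_eq_iff forall_2 axis_def abs_ltwo_scale_real abs_ltwo_lincomb
        schwartz_creation schwartz_annihilation f scaleR_ltwo_def[symmetric]
        del: of_real_add of_real_mult of_real_divide)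
qed

lemma rabi_ham_down:
  assumes "number_eigenfunction \<mu> f"
  shows "(axis 2 (abs_ltwo f), (- \<omega> / 2 + \<omega> * \<mu>) *\<^sub>R axis 2 (abs_ltwo f)
      + lam *\<^sub>R axis 1 (abs_ltwo (annihilation f)) + lam *\<^sub>R axis 1 (abs_ltwo (creation f)))
    \<in> closed_op (rabi_ham \<omega> \<omega> lam)"
proof (rule closed_op_tensor_axis)
  have f: "schwartz f" and eig: "creation (annihilation f) = (\<lambda>x. complex_of_real \<mu> * f x)"
    using assms by (simp_all add: number_eigenfunction_def)
  show "schwartz f" by fact
  have "rabi_ham \<omega> \<omega> lam (axis 2 1 \<otimes>\<^sub>v f) = (\<chi> i. if i = 1
      then (\<lambda>x. complex_of_real lam * annihilation f x + complex_of_real lam * creation f x)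
      else (\<lambda>x. complex_of_real (- \<omega> / 2 + \<omega> * \<mu>) * f x))"
    by (simp add: rabi_ham_def ham_simps eig vec_eq_iff forall_2 fun_eq_iff algebra_simps)
  then show "class_of (rabi_ham \<omega> \<omega> lam (axis 2 1 \<otimes>\<^sub>v f)) =
      (- \<omega> / 2 + \<omega> * \<mu>) *\<^sub>R axis 2 (abs_ltwo f) + lam *\<^sub>R axis 1 (abs_ltwo (annihilation f))
      + lam *\<^sub>R axis 1 (abs_ltwo (creation f))"
    by (simp add: class_of_def vec_eq_iff forall_2 axis_def abs_ltwo_scale_real abs_ltwo_lincomb
        schwartz_creation schwartz_annihilation f scaleR_ltwo_def[symmetric]
        del: of_real_add of_real_mult of_real_divide of_real_minus of_real_diff)
qed

section \<open>Fock states\<close>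

context
  fixes f :: "real \<Rightarrow> complex" and n lam \<omega> :: real and E R :: "real \<Rightarrow> state \<Rightarrow> state"
  assumes n: "n \<ge> 1" and lam: "lam > 0" and \<omega>: "\<omega> > 0"
    and f: "number_eigenfunction n f" and norm_f: "norm (abs_ltwo f) = 1"
    and E: "exp_group (closed_op (rabi_ham \<omega> \<omega> lam)) E"
    and R: "exp_group (closed_op (rwa_ham \<omega> \<omega> lam)) R"
begin

lemma f_schwartz: "schwartz f"
  using f by (simp add: number_eigenfunction_def)

lemma number_f: "abs_ltwo (creation (annihilation f)) = n *\<^sub>R abs_ltwo f"
  using f by (simp add: number_eigenfunction_def abs_ltwo_scale_real)

lemma antinumber_f: "abs_ltwo (annihilation (creation f)) = (n + 1) *\<^sub>R abs_ltwo f"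
  unfolding annihilation_creation_eigenfunction[OF f] by (rule abs_ltwo_scale_real[OF f_schwartz])

lemmas af = number_eigenfunction_annihilation[OF f]
lemmas cf = number_eigenfunction_creation[OF f]
lemmas aaf = number_eigenfunction_annihilation[OF af]
lemmas ccf = number_eigenfunction_creation[OF cf]

lemma norm_ladder:
  "(norm (abs_ltwo (annihilation f)))\<^sup>2 = n"
  "(norm (abs_ltwo (creation f)))\<^sup>2 = n + 1"
  "(norm (abs_ltwo (annihilation (annihilation f))))\<^sup>2 = (n - 1) * n"
  "(norm (abs_ltwo (creation (creation f))))\<^sup>2 = (n + 2) * (n + 1)"
  by (simp_all add: norm_annihilation_eigenfunction[OF f] norm_creation_eigenfunction[OF f]
      norm_annihilation_eigenfunction[OF af] norm_creation_eigenfunction[OF cf] norm_f)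

text \<open>Spin up: the RWA partner raises the mode (\<kappa> = n + 1) and the counter-rotating
  image lowers it (\<nu> = n). The value of M is exact for q'.\<close>

lemma perturbed_doublet_up:
  "perturbed_doublet (closed_op (rabi_ham \<omega> \<omega> lam)) (closed_op (rwa_ham \<omega> \<omega> lam)) E R
    (axis 1 (abs_ltwo f)) (axis 2 (abs_ltwo (creation f)))
    (axis 2 (abs_ltwo (annihilation f))) (axis 1 (abs_ltwo (creation (creation f))))
    (axis 1 (abs_ltwo (annihilation (annihilation f))))
    (\<omega> / 2 + \<omega> * n) (- \<omega> / 2 + \<omega> * (n - 1)) lam (n + 1) n (sqrt (n + 2))"
proof
  \<comment> \<open>Resonance: the extra quantum in q pays for its flipped spin.\<close>
  have c: "- \<omega> / 2 + \<omega> * (n + 1) = \<omega> / 2 + \<omega> * n"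
    by (simp add: algebra_simps)
  show "(axis 2 (abs_ltwo (creation f)), (\<omega> / 2 + \<omega> * n) *\<^sub>R axis 2 (abs_ltwo (creation f))
      + (lam * (n + 1)) *\<^sub>R axis 1 (abs_ltwo f)) \<in> closed_op (rwa_ham \<omega> \<omega> lam)"
    using rwa_ham_down[OF cf, of \<omega> lam] unfolding c antinumber_f by (simp add: scaleR_axis)
  show "(axis 2 (abs_ltwo (creation f)), (\<omega> / 2 + \<omega> * n) *\<^sub>R axis 2 (abs_ltwo (creation f))
      + (lam * (n + 1)) *\<^sub>R axis 1 (abs_ltwo f) + lam *\<^sub>R axis 1 (abs_ltwo (creation (creation f))))
      \<in> closed_op (rabi_ham \<omega> \<omega> lam)"
    using rabi_ham_down[OF cf, of \<omega> lam] unfolding c antinumber_f by (simp add: scaleR_axis)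
  show "(axis 2 (abs_ltwo (annihilation f)),
      (- \<omega> / 2 + \<omega> * (n - 1)) *\<^sub>R axis 2 (abs_ltwo (annihilation f))
      + (lam * n) *\<^sub>R axis 1 (abs_ltwo f) + lam *\<^sub>R axis 1 (abs_ltwo (annihilation (annihilation f))))
      \<in> closed_op (rabi_ham \<omega> \<omega> lam)"
    using rabi_ham_down[OF af, of \<omega> lam] unfolding number_f by (simp add: scaleR_axis add_ac)
  show "(axis 1 (abs_ltwo f), (\<omega> / 2 + \<omega> * n) *\<^sub>R axis 1 (abs_ltwo f)
      + lam *\<^sub>R axis 2 (abs_ltwo (creation f))) \<in> closed_op (rwa_ham \<omega> \<omega> lam)"
    by (rule rwa_ham_up[OF f])
  show "(axis 1 (abs_ltwo f), (\<omega> / 2 + \<omega> * n) *\<^sub>R axis 1 (abs_ltwo f)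
      + lam *\<^sub>R axis 2 (abs_ltwo (creation f)) + lam *\<^sub>R axis 2 (abs_ltwo (annihilation f)))
      \<in> closed_op (rabi_ham \<omega> \<omega> lam)"
    by (rule rabi_ham_up[OF f])
  have na: "norm (abs_ltwo (annihilation f)) = sqrt n"
    "norm (abs_ltwo (creation (creation f))) = sqrt (n + 1) * sqrt (n + 2)"
    using real_sqrt_unique[OF norm_ladder(1)] real_sqrt_unique[OF norm_ladder(4)]
    by (simp_all add: real_sqrt_mult mult.commute)
  show "norm (axis 2 (abs_ltwo (annihilation f)) :: state) = sqrt n"
    "norm (axis 2 (abs_ltwo (annihilation f)) :: state) \<le> sqrt (n + 2)"
    "norm (axis 1 (abs_ltwo (creation (creation f))) :: state) \<le> sqrt (n + 1) * sqrt (n + 2)"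
    "(norm (axis 1 (abs_ltwo (annihilation (annihilation f))) :: state))\<^sup>2 \<le> n * (n + 1)"
    "norm (axis 1 (abs_ltwo f) :: state) = 1"
    using n by (simp_all add: norm_axis na norm_ladder norm_f algebra_simps)
\<comment> \<open>Only p', q and r, p share a spin component; their number eigenvalues n - 1, n + 1
  and n - 2, n differ.\<close>
qed (use n lam E R number_eigenfunctions_orthogonal[OF af cf] number_eigenfunctions_orthogonal[OF aaf f]
  in \<open>auto intro!: corthogonal_axis\<close>)

text \<open>Spin down exchanges the roles of raising and lowering, so \<kappa> = n and \<nu> = n +
  1; here the bound on r is an equality.\<close>

lemma perturbed_doublet_down:
  "perturbed_doublet (closed_op (rabi_ham \<omega> \<omega> lam)) (closed_op (rwa_ham \<omega> \<omega> lam)) E R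
    (axis 2 (abs_ltwo f)) (axis 1 (abs_ltwo (annihilation f)))
    (axis 1 (abs_ltwo (creation f))) (axis 2 (abs_ltwo (annihilation (annihilation f))))
    (axis 2 (abs_ltwo (creation (creation f))))
    (- \<omega> / 2 + \<omega> * n) (\<omega> / 2 + \<omega> * (n + 1)) lam n (n + 1) (sqrt (n + 2))"
proof
  have c: "\<omega> / 2 + \<omega> * (n - 1) = - \<omega> / 2 + \<omega> * n"
    by (simp add: algebra_simps)
  show "(axis 1 (abs_ltwo (annihilation f)), (- \<omega> / 2 + \<omega> * n) *\<^sub>R axis 1 (abs_ltwo (annihilation f))
      + (lam * n) *\<^sub>R axis 2 (abs_ltwo f)) \<in> closed_op (rwa_ham \<omega> \<omega> lam)"
    using rwa_ham_up[OF af, of \<omega> lam] unfolding c number_f by (simp add: scaleR_axis)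
  show "(axis 1 (abs_ltwo (annihilation f)), (- \<omega> / 2 + \<omega> * n) *\<^sub>R axis 1 (abs_ltwo (annihilation f))
      + (lam * n) *\<^sub>R axis 2 (abs_ltwo f) + lam *\<^sub>R axis 2 (abs_ltwo (annihilation (annihilation f))))
      \<in> closed_op (rabi_ham \<omega> \<omega> lam)"
    using rabi_ham_up[OF af, of \<omega> lam] unfolding c number_f by (simp add: scaleR_axis)
  show "(axis 1 (abs_ltwo (creation f)),
      (\<omega> / 2 + \<omega> * (n + 1)) *\<^sub>R axis 1 (abs_ltwo (creation f))
      + (lam * (n + 1)) *\<^sub>R axis 2 (abs_ltwo f) + lam *\<^sub>R axis 2 (abs_ltwo (creation (creation f))))
      \<in> closed_op (rabi_ham \<omega> \<omega> lam)"
    using rabi_ham_up[OF cf, of \<omega> lam] unfolding antinumber_f by (simp add: scaleR_axis add_ac)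
  show "(axis 2 (abs_ltwo f), (- \<omega> / 2 + \<omega> * n) *\<^sub>R axis 2 (abs_ltwo f)
      + lam *\<^sub>R axis 1 (abs_ltwo (annihilation f))) \<in> closed_op (rwa_ham \<omega> \<omega> lam)"
    by (rule rwa_ham_down[OF f])
  show "(axis 2 (abs_ltwo f), (- \<omega> / 2 + \<omega> * n) *\<^sub>R axis 2 (abs_ltwo f)
      + lam *\<^sub>R axis 1 (abs_ltwo (annihilation f)) + lam *\<^sub>R axis 1 (abs_ltwo (creation f)))
      \<in> closed_op (rabi_ham \<omega> \<omega> lam)"
    by (rule rabi_ham_down[OF f])
  have nc: "norm (abs_ltwo (creation f)) = sqrt (n + 1)"
    using norm_ladder by (simp add: real_sqrt_unique)
  have "norm (abs_ltwo (annihilation (annihilation f))) \<le> sqrt (n * (n + 2))"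
    using n by (intro real_le_rsqrt) (simp add: norm_ladder algebra_simps)
  then show "norm (axis 2 (abs_ltwo (annihilation (annihilation f))) :: state) \<le> sqrt n * sqrt (n + 2)"
    by (simp add: norm_axis real_sqrt_mult)
  show "norm (axis 1 (abs_ltwo (creation f)) :: state) = sqrt (n + 1)"
    "norm (axis 1 (abs_ltwo (creation f)) :: state) \<le> sqrt (n + 2)"
    "(norm (axis 2 (abs_ltwo (creation (creation f))) :: state))\<^sup>2 \<le> (n + 1) * (n + 1 + 1)"
    "norm (axis 2 (abs_ltwo f) :: state) = 1"
    using n by (simp_all add: norm_axis nc norm_ladder norm_f algebra_simps)
qed (use n lam E R number_eigenfunctions_orthogonal[OF cf af] number_eigenfunctions_orthogonal[OF ccf f]
  in \<open>auto intro!: corthogonal_axis\<close>)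

end

theorem mainTheorem3:
  fixes lam \<omega> \<Omega> g :: real
    and \<phi> :: "nat \<Rightarrow> real \<Rightarrow> complex"
    and E\<^sub>0 E E\<^sub>R\<^sub>W\<^sub>A U\<^sub>1 U\<^sub>2 :: "real \<Rightarrow> state \<Rightarrow> state"
    and j :: 2 and n :: nat
  assumes "lam > 0" and "\<omega> > 0" and "\<Omega> = \<omega>" and "g = lam / \<omega>"
    and "number_eigenbasis \<phi>"
    and "exp_group (closed_op (free_ham \<omega>)) E\<^sub>0"
    and "exp_group (closed_op (rabi_ham \<Omega> \<omega> lam)) E"
    and "exp_group (closed_op (rwa_ham \<Omega> \<omega> lam)) E\<^sub>R\<^sub>W\<^sub>A"
    and "\<And>t. U\<^sub>1 t = E\<^sub>0 t \<circ> E (- t)"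
    and "\<And>t. U\<^sub>2 t = E\<^sub>0 t \<circ> E\<^sub>R\<^sub>W\<^sub>A (- t)"
    and "n \<ge> 1"
  shows "5 * g * sqrt (real n + 3) \<ge>
           (SUP t\<in>{0..pi / \<omega>}. norm (U\<^sub>2 t (class_of (axis j 1 \<otimes>\<^sub>v \<phi> n))
                                   - U\<^sub>1 t (class_of (axis j 1 \<otimes>\<^sub>v \<phi> n)))) \<and>
         (SUP t\<in>{0..pi / \<omega>}. norm (U\<^sub>2 t (class_of (axis j 1 \<otimes>\<^sub>v \<phi> n))
                                   - U\<^sub>1 t (class_of (axis j 1 \<otimes>\<^sub>v \<phi> n)))) \<ge>
           1 / 6 - 1 / (216 * g\<^sup>2 * real n) - 7 / (12 * real n)"
proof -
  have f: "number_eigenfunction (real n) (\<phi> n)"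
    using assms(5) by (simp add: number_eigenbasis_def number_eigenfunction_def fun_eq_iff)
  have norm_f: "norm (abs_ltwo (\<phi> n)) = 1"
    using assms(5) by (simp add: number_eigenbasis_def norm_ltwo_def inner_ltwo_def)
  have n: "1 \<le> real n"
    using assms(11) by simp
  note groups = assms(7,8)[unfolded assms(3)]
  consider "j = 1" | "j = 2"
    using exhaust_2[of j] by blast
  then show ?thesis
  proof cases
    case 1
    interpret perturbed_doublet "closed_op (rabi_ham \<omega> \<omega> lam)" "closed_op (rwa_ham \<omega> \<omega> lam)" E E\<^sub>R\<^sub>W\<^sub>A
      "axis 1 (abs_ltwo (\<phi> n))" "axis 2 (abs_ltwo (creation (\<phi> n)))"
      "axis 2 (abs_ltwo (annihilation (\<phi> n)))" "axis 1 (abs_ltwo (creation (creation (\<phi> n))))"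
      "axis 1 (abs_ltwo (annihilation (annihilation (\<phi> n))))"
      "\<omega> / 2 + \<omega> * real n" "- \<omega> / 2 + \<omega> * (real n - 1)" lam "real n + 1" "real n" "sqrt (real n + 2)"
      by (rule perturbed_doublet_up[OF n assms(1,2) f norm_f groups])
    show ?thesis
      unfolding 1 class_of_tensor_axis
      \<comment> \<open>The open slots are n \<le> \<nu>, \<kappa> \<le> 2 * \<nu>, the value of M
        and the energy gap; the second holds because n \<ge> 1.\<close>
      by (intro conjI sup_deviation_bounds[OF assms(6,2,4) n _ _ _ _ assms(9,10)])
        (use n in \<open>simp_all add: power2_eq_square algebra_simps\<close>)
  next
    case 2
    interpret perturbed_doublet "closed_op (rabi_ham \<omega> \<omega> lam)" "closed_op (rwa_ham \<omega> \<omega> lam)" E E\<^sub>R\<^sub>W\<^sub>A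
      "axis 2 (abs_ltwo (\<phi> n))" "axis 1 (abs_ltwo (annihilation (\<phi> n)))"
      "axis 1 (abs_ltwo (creation (\<phi> n)))" "axis 2 (abs_ltwo (annihilation (annihilation (\<phi> n))))"
      "axis 2 (abs_ltwo (creation (creation (\<phi> n))))"
      "- \<omega> / 2 + \<omega> * real n" "\<omega> / 2 + \<omega> * (real n + 1)" lam "real n" "real n + 1" "sqrt (real n + 2)"
      by (rule perturbed_doublet_down[OF n assms(1,2) f norm_f groups])
    show ?thesis
      unfolding 2 class_of_tensor_axis
      by (intro conjI sup_deviation_bounds[OF assms(6,2,4) n _ _ _ _ assms(9,10)])
        (use n in \<open>simp_all add: power2_eq_square algebra_simps\<close>)
  qed
qed

end
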